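(* Let $n,k\ge1$ be integers. For each $i\in\{0,1,\dots,k\}$ let $\mathcal V_i:=\{v_i^1,\dots,v_i^{s_i}\}\subset\mathbb{R}^{n_i}$ be a finite set ($s_i\ge1$) and suppose that $f_i(\cdot,v_i)$ is an SOS-convex polynomial on $\mathbb{R}^n$ for each $v_i\in\mathcal V_i$. Let $r:=s_0$. Assume that there exists $\bar x\in\mathbb{R}^n$ such that $f_i(\bar x,v_i^j)<0$ for all $j=1,\dots,s_i$ and $i=1,\dots,k$. Consider $$(RP)\quad \inf_{x\in\mathbb{R}^n}\Big\{\sup_{v_0\in\mathcal V_0}f_0(x,v_0) : f_i(x,v_i)\le 0\ \ \forall v_i\in\mathcal V_i,\ \forall i=1,\dots,k\Big\}$$ and $$(RD)\quad \sup\Big\{\mu : \sum_{l=1}^r\delta_lf_0(\cdot,v_0^l)+\sum_{i=1}^k\sum_{j=1}^{s_i}\lambda_i^jf_i(\cdot,v_i^j)-\mu\in\Sigma^2_t,\ \delta\in\Delta,\ \lambda_i\in\mathbb{R}^{s_i}_+\ (i=1,\dots,k),\ \mu\in\mathbb{R}\Big\},$$ where $t$ is the smallest even number such that $t\ge\max\{\max_{1\le l\le r}\deg f_0(\cdot,v_0^l),\ \max_{1\le i\le k}\max_{1\le j\le s_i}\deg f_i(\cdot,v_i^j)\}$. Then $$\inf(RP)=\max(RD).$$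
   Context: $\mathbb{R}^q_+$ denotes the set of vectors in $\mathbb{R}^q$ with nonnegative coordinates, and $\Delta:=\{\delta\in\mathbb{R}^r_+ : \sum_{l=1}^r\delta_l=1\}$. A real polynomial $f$ on $\mathbb{R}^n$ is a sum of squares if it is a finite sum of squares of real polynomials; $\Sigma^2_t$ is the set of sum of squares real polynomials on $\mathbb{R}^n$ of degree at most $t$. A real polynomial $f$ on $\mathbb{R}^n$ is SOS-convex if its Hessian is an SOS-matrix polynomial, i.e. $\nabla^2 f(x)=H(x)H(x)^T$ for some $s\in\mathbb{N}$ and some matrix polynomial $H\in\mathbb{R}[x]^{n\times s}$. $\inf(RP)$ denotes the optimal value of $(RP)$; writing $\max(RD)$ for the optimal value of $(RD)$ means that the supremum in $(RD)$ is attained.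
   Formalization: Attainment of the supremum in (RD) is claimed only when its value is not −∞; if inf(RP) = −∞ (e.g. f_0(x) = x, f_1 = −1), (RD) is infeasible and only equality of the optimal values in the extended reals is asserted. *)

theory Defs
  imports "HOL-Analysis.Analysis"
begin

text \<open>
  Polynomials on \<open>\<real>\<^sup>n\<close> are rendered by their polynomial functions
  (\<^const>\<open>real_polynomial_function\<close>); over the reals the two notions agree. A point
  of \<open>\<real>\<^sup>n\<close> is a vector of type \<open>real^'n\<close>.
\<close>

definition monomial_fun :: "('n::finite \<Rightarrow> nat) \<Rightarrow> real^'n \<Rightarrow> real" where
  "monomial_fun \<alpha> x = (\<Prod>i\<in>UNIV. (x $ i) ^ \<alpha> i)"

lemma finite_bounded_exponents: "finite {\<alpha> :: 'n::finite \<Rightarrow> nat. (\<Sum>i\<in>UNIV. \<alpha> i) \<le> d}"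
proof (rule finite_subset)
  show "{\<alpha> :: 'n \<Rightarrow> nat. (\<Sum>i\<in>UNIV. \<alpha> i) \<le> d} \<subseteq> (\<Pi>\<^sub>E i\<in>UNIV. {..d})"
  proof
    fix \<alpha> :: "'n \<Rightarrow> nat"
    assume "\<alpha> \<in> {\<alpha>. (\<Sum>i\<in>UNIV. \<alpha> i) \<le> d}"
    moreover have "\<alpha> i \<le> (\<Sum>i\<in>UNIV. \<alpha> i)" for i
      by (rule member_le_sum) simp_all
    ultimately have "\<alpha> i \<le> d" for i
      using le_trans by blast
    then show "\<alpha> \<in> (\<Pi>\<^sub>E i\<in>UNIV. {..d})"
      by (simp add: PiE_iff)
  qed
  show "finite (\<Pi>\<^sub>E i\<in>(UNIV::'n set). {..d})"
    by (intro finite_PiE) auto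
qed

text \<open>
  Total degree; the zero polynomial is given degree \<open>0\<close>. Meaningful for polynomial
  functions only.
\<close>

definition poly_degree :: "(real^'n::finite \<Rightarrow> real) \<Rightarrow> nat" where
  "poly_degree p =
     (LEAST d. \<exists>c. \<forall>x. p x = (\<Sum>\<alpha> | (\<Sum>i\<in>UNIV. \<alpha> i) \<le> d. c \<alpha> * monomial_fun \<alpha> x))"

definition sum_of_squares :: "(real^'n::finite \<Rightarrow> real) \<Rightarrow> bool" where
  "sum_of_squares p \<longleftrightarrow>
     (\<exists>(m::nat) q. (\<forall>l<m. real_polynomial_function (q l)) \<and> (\<forall>x. p x = (\<Sum>l<m. (q l x)\<^sup>2)))"

definition SOS_deg :: "nat \<Rightarrow> (real^'n::finite \<Rightarrow> real) set" where
  "SOS_deg t = {p. real_polynomial_function p \<and> sum_of_squares p \<and> poly_degree p \<le> t}"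

definition partial_deriv :: "'n \<Rightarrow> (real^'n::finite \<Rightarrow> real) \<Rightarrow> real^'n \<Rightarrow> real" where
  "partial_deriv i p x = frechet_derivative p (at x) (axis i 1)"

definition hessian :: "(real^'n::finite \<Rightarrow> real) \<Rightarrow> real^'n \<Rightarrow> real^'n^'n" where
  "hessian p x = (\<chi> i j. partial_deriv i (partial_deriv j p) x)"

text \<open>
  The number \<open>s\<close> of columns of the matrix polynomial \<open>H\<close> is existentially quantified, so
  the columns are indexed by \<open>{..<s}\<close> and \<open>(H(x) H(x)\<^sup>T) i j = (\<Sum>l<s. H i l x * H j l x)\<close>.
\<close>

definition SOS_matrix_polynomial :: "(real^'n::finite \<Rightarrow> real^'n^'n) \<Rightarrow> bool" where
  "SOS_matrix_polynomial M \<longleftrightarrow>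
     (\<exists>(s::nat) H. (\<forall>i. \<forall>l<s. real_polynomial_function (H i l)) \<and>
        (\<forall>x i j. M x $ i $ j = (\<Sum>l<s. H i l x * H j l x)))"

definition SOS_convex :: "(real^'n::finite \<Rightarrow> real) \<Rightarrow> bool" where
  "SOS_convex p \<longleftrightarrow> real_polynomial_function p \<and> SOS_matrix_polynomial (hessian p)"

text \<open>
  Only the coordinates \<open>1, \<dots>, r\<close> of an element of \<open>\<Delta>\<close> are relevant.
\<close>

definition simplex_weights :: "nat \<Rightarrow> (nat \<Rightarrow> real) set" where
  "simplex_weights r = {\<delta>. (\<forall>l\<in>{1..r}. 0 \<le> \<delta> l) \<and> (\<Sum>l=1..r. \<delta> l) = 1}"

text \<open>
  In the sequel \<open>V i\<close> is the uncertainty set of the \<open>i\<close>-th function, \<open>v i j\<close> (\<open>1 \<le> j \<le> s i\<close>) its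
  enumeration, and \<open>f i x w\<close> stands for \<open>f\<^sub>i(x, w)\<close>. Optimal values are extended reals,
  so that an infeasible maximisation problem has value \<open>-\<infinity>\<close>.
\<close>

definition RP_feasible ::
  "nat \<Rightarrow> (nat \<Rightarrow> 'v set) \<Rightarrow> (nat \<Rightarrow> real^'n::finite \<Rightarrow> 'v \<Rightarrow> real) \<Rightarrow> (real^'n) set" where
  "RP_feasible k V f = {x. \<forall>i\<in>{1..k}. \<forall>w\<in>V i. f i x w \<le> 0}"

definition RP_value ::
  "nat \<Rightarrow> (nat \<Rightarrow> 'v set) \<Rightarrow> (nat \<Rightarrow> real^'n::finite \<Rightarrow> 'v \<Rightarrow> real) \<Rightarrow> ereal" where
  "RP_value k V f = (INF x\<in>RP_feasible k V f. SUP w\<in>V 0. ereal (f 0 x w))"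

definition RD_degree ::
  "nat \<Rightarrow> (nat \<Rightarrow> nat) \<Rightarrow> (nat \<Rightarrow> nat \<Rightarrow> 'v) \<Rightarrow> (nat \<Rightarrow> real^'n::finite \<Rightarrow> 'v \<Rightarrow> real) \<Rightarrow> nat" where
  "RD_degree k s v f =
     (LEAST t. even t \<and>
        max (MAX l\<in>{1..s 0}. poly_degree (\<lambda>x. f 0 x (v 0 l)))
            (MAX i\<in>{1..k}. MAX j\<in>{1..s i}. poly_degree (\<lambda>x. f i x (v i j))) \<le> t)"

definition RD_feasible ::
  "nat \<Rightarrow> (nat \<Rightarrow> nat) \<Rightarrow> (nat \<Rightarrow> nat \<Rightarrow> 'v) \<Rightarrow> (nat \<Rightarrow> real^'n::finite \<Rightarrow> 'v \<Rightarrow> real)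
     \<Rightarrow> ((nat \<Rightarrow> real) \<times> (nat \<Rightarrow> nat \<Rightarrow> real) \<times> real) set" where
  "RD_feasible k s v f =
     {(\<delta>, \<Lambda>, \<mu>).
        \<delta> \<in> simplex_weights (s 0) \<and>
        (\<forall>i\<in>{1..k}. \<forall>j\<in>{1..s i}. 0 \<le> \<Lambda> i j) \<and>
        (\<lambda>x. (\<Sum>l=1..s 0. \<delta> l * f 0 x (v 0 l))
            + (\<Sum>i=1..k. \<Sum>j=1..s i. \<Lambda> i j * f i x (v i j)) - \<mu>)
          \<in> SOS_deg (RD_degree k s v f)}"

definition RD_value ::
  "nat \<Rightarrow> (nat \<Rightarrow> nat) \<Rightarrow> (nat \<Rightarrow> nat \<Rightarrow> 'v) \<Rightarrow> (nat \<Rightarrow> real^'n::finite \<Rightarrow> 'v \<Rightarrow> real) \<Rightarrow> ereal" where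
  "RD_value k s v f = (SUP (\<delta>, \<Lambda>, \<mu>)\<in>RD_feasible k s v f. ereal \<mu>)"

end

theory Submission
  imports Defs
begin

text \<open>
  For \<open>\<inf>(RP) = \<mu>\<close> finite, the functions \<open>f\<^sub>0(\<cdot>, v\<^sub>0\<^sup>l) - \<mu>\<close> and \<open>f\<^sub>i(\<cdot>, v\<^sub>i\<^sup>j)\<close> are convex and never simultaneously
  negative, so some nontrivial nonnegative combination of them is nonnegative everywhere; the
  Slater point forces positive weight on the objectives, and normalising gives a nonnegative
  SOS-convex polynomial \<open>g\<close>. A convex polynomial that is bounded below attains its minimum, at \<open>u\<close>
  say, where its gradient vanishes. By Taylor's formula \<open>g - g(u)\<close> is then the integral of
  \<open>(1 - t) (x - u)\<^sup>T H H\<^sup>T (x - u)\<close> along the segment from \<open>u\<close> to \<open>x\<close>. The integrand is a sum of squares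
  of polynomials in \<open>x\<close> and \<open>t\<close>, and integrating out \<open>t\<close> leaves positive semidefinite quadratic forms in
  polynomials of \<open>x\<close>, so \<open>g\<close> is a sum of squares.
\<close>

section \<open>Degrees of polynomial functions\<close>

text \<open>\<open>poly_degree\<close> is the least such \<open>d\<close>. Upper bounds survive
  cancellation in sums, as exact degrees do not, so degree estimates are carried out with this
  predicate.\<close>

definition degree_at_most :: "nat \<Rightarrow> (real^'n::finite \<Rightarrow> real) \<Rightarrow> bool" where
  "degree_at_most d p \<longleftrightarrow>
     (\<exists>c. \<forall>x. p x = (\<Sum>\<alpha> | (\<Sum>i\<in>UNIV. \<alpha> i) \<le> d. c \<alpha> * monomial_fun \<alpha> x))"

lemma poly_degree_le: "degree_at_most d p \<Longrightarrow> poly_degree p \<le> d"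
  unfolding poly_degree_def degree_at_most_def by (rule Least_le)

lemma degree_at_most_add:
  assumes "degree_at_most d p" "degree_at_most d q"
  shows "degree_at_most d (\<lambda>x. p x + q x)"
proof -
  obtain b c where "\<forall>x. p x = (\<Sum>\<alpha> | (\<Sum>i\<in>UNIV. \<alpha> i) \<le> d. b \<alpha> * monomial_fun \<alpha> x)"
    "\<forall>x. q x = (\<Sum>\<alpha> | (\<Sum>i\<in>UNIV. \<alpha> i) \<le> d. c \<alpha> * monomial_fun \<alpha> x)"
    using assms unfolding degree_at_most_def by blast
  then have "\<forall>x. p x + q x = (\<Sum>\<alpha> | (\<Sum>i\<in>UNIV. \<alpha> i) \<le> d. (b \<alpha> + c \<alpha>) * monomial_fun \<alpha> x)"
    by (simp add: sum.distrib distrib_right)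
  then show ?thesis
    unfolding degree_at_most_def by (rule exI[where x="\<lambda>\<alpha>. b \<alpha> + c \<alpha>"])
qed

lemma degree_at_most_cmult:
  assumes "degree_at_most d p"
  shows "degree_at_most d (\<lambda>x. a * p x)"
proof -
  obtain c where "\<forall>x. p x = (\<Sum>\<alpha> | (\<Sum>i\<in>UNIV. \<alpha> i) \<le> d. c \<alpha> * monomial_fun \<alpha> x)"
    using assms unfolding degree_at_most_def by blast
  then have "\<forall>x. a * p x = (\<Sum>\<alpha> | (\<Sum>i\<in>UNIV. \<alpha> i) \<le> d. (a * c \<alpha>) * monomial_fun \<alpha> x)"
    by (simp add: sum_distrib_left mult.assoc)
  then show ?thesis
    unfolding degree_at_most_def by (rule exI[where x="\<lambda>\<alpha>. a * c \<alpha>"])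
qed

lemma degree_at_most_monomial:
  assumes "(\<Sum>i\<in>UNIV. \<alpha> i) \<le> d"
  shows "degree_at_most d (monomial_fun \<alpha>)"
  unfolding degree_at_most_def
proof (intro exI allI)
  fix x :: "real^'a"
  have "(\<Sum>\<beta> | (\<Sum>i\<in>UNIV. \<beta> i) \<le> d. (if \<beta> = \<alpha> then 1 else 0) * monomial_fun \<beta> x)
      = (\<Sum>\<beta> | (\<Sum>i\<in>UNIV. \<beta> i) \<le> d. if \<beta> = \<alpha> then monomial_fun \<beta> x else 0)"
    by (rule sum.cong) auto
  also have "\<dots> = monomial_fun \<alpha> x"
    using assms by (subst sum.delta[OF finite_bounded_exponents]) auto
  finally show "monomial_fun \<alpha> x =
      (\<Sum>\<beta> | (\<Sum>i\<in>UNIV. \<beta> i) \<le> d. (if \<beta> = \<alpha> then 1 else 0) * monomial_fun \<beta> x)"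
    by simp
qed

lemma degree_at_most_const: "degree_at_most d (\<lambda>x. a)"
proof -
  have "degree_at_most d (\<lambda>x. a * monomial_fun (\<lambda>_. 0) x)"
    by (intro degree_at_most_cmult degree_at_most_monomial) simp
  then show ?thesis
    by (simp add: monomial_fun_def)
qed

lemma degree_at_most_sum:
  "(\<And>i. i \<in> I \<Longrightarrow> degree_at_most d (p i)) \<Longrightarrow> degree_at_most d (\<lambda>x. \<Sum>i\<in>I. p i x)"
  by (induction I rule: infinite_finite_induct)
    (simp_all add: degree_at_most_const degree_at_most_add)

lemma degree_at_most_mono:
  assumes "degree_at_most d p" "d \<le> e"
  shows "degree_at_most e p"
proof -
  obtain c where c: "\<forall>x. p x = (\<Sum>\<alpha> | (\<Sum>i\<in>UNIV. \<alpha> i) \<le> d. c \<alpha> * monomial_fun \<alpha> x)"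
    using assms unfolding degree_at_most_def by blast
  have "degree_at_most e (\<lambda>x. \<Sum>\<alpha> | (\<Sum>i\<in>UNIV. \<alpha> i) \<le> d. c \<alpha> * monomial_fun \<alpha> x)"
    using \<open>d \<le> e\<close> by (intro degree_at_most_sum degree_at_most_cmult degree_at_most_monomial) auto
  moreover have "p = (\<lambda>x. \<Sum>\<alpha> | (\<Sum>i\<in>UNIV. \<alpha> i) \<le> d. c \<alpha> * monomial_fun \<alpha> x)"
    using c by auto
  ultimately show ?thesis
    by simp
qed

lemma monomial_fun_mult:
  "monomial_fun \<alpha> x * monomial_fun \<beta> x = monomial_fun (\<lambda>i. \<alpha> i + \<beta> i) x"
  by (simp add: monomial_fun_def power_add prod.distrib)

lemma degree_at_most_mult:
  assumes "degree_at_most d p" "degree_at_most e q"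
  shows "degree_at_most (d + e) (\<lambda>x. p x * q x)"
proof -
  obtain b c where
    p: "\<forall>x. p x = (\<Sum>\<alpha> | (\<Sum>i\<in>UNIV. \<alpha> i) \<le> d. b \<alpha> * monomial_fun \<alpha> x)" and
    q: "\<forall>x. q x = (\<Sum>\<alpha> | (\<Sum>i\<in>UNIV. \<alpha> i) \<le> e. c \<alpha> * monomial_fun \<alpha> x)"
    using assms unfolding degree_at_most_def by blast
  have "degree_at_most (d + e) (\<lambda>x. \<Sum>\<alpha> | (\<Sum>i\<in>UNIV. \<alpha> i) \<le> d. \<Sum>\<beta> | (\<Sum>i\<in>UNIV. \<beta> i) \<le> e.
      (b \<alpha> * c \<beta>) * monomial_fun (\<lambda>i. \<alpha> i + \<beta> i) x)"
    by (intro degree_at_most_sum degree_at_most_cmult degree_at_most_monomial)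
      (auto simp: sum.distrib intro: add_mono)
  moreover have "p x * q x = (\<Sum>\<alpha> | (\<Sum>i\<in>UNIV. \<alpha> i) \<le> d. \<Sum>\<beta> | (\<Sum>i\<in>UNIV. \<beta> i) \<le> e.
      (b \<alpha> * c \<beta>) * monomial_fun (\<lambda>i. \<alpha> i + \<beta> i) x)" for x
    unfolding p[rule_format] q[rule_format] sum_product
    by (intro sum.cong refl) (simp add: monomial_fun_mult[symmetric] algebra_simps)
  ultimately show ?thesis
    by simp
qed

lemma degree_at_most_component: "degree_at_most 1 (\<lambda>x. x $ i)"
proof -
  have "degree_at_most 1 (monomial_fun (\<lambda>j. if j = i then 1 else 0))"
    by (intro degree_at_most_monomial) simp
  moreover have "monomial_fun (\<lambda>j. if j = i then 1 else 0) x = x $ i" for x :: "real^'a"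
  proof -
    have "monomial_fun (\<lambda>j. if j = i then 1 else 0) x = (\<Prod>j\<in>UNIV. if j = i then x $ j else 1)"
      unfolding monomial_fun_def by (rule prod.cong) auto
    then show ?thesis
      by simp
  qed
  ultimately show ?thesis
    by (metis (no_types, lifting) ext)
qed

text \<open>Shows that the \<open>LEAST\<close> in \<open>poly_degree\<close> is attained. A linear
  functional is a combination of the coordinates, with its values at the unit vectors as
  coefficients.\<close>

lemma degree_at_most_exists: "real_polynomial_function p \<Longrightarrow> \<exists>d. degree_at_most d p"
proof (induction rule: real_polynomial_function.induct)
  case (linear f)
  have "f x = (\<Sum>i\<in>UNIV. f (axis i 1) * x $ i)" for x
  proof -
    have "f x = f (\<Sum>i\<in>UNIV. x $ i *\<^sub>R axis i 1)"
      by (simp add: basis_expansion[of x, unfolded scalar_mult_eq_scaleR])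
    also have "\<dots> = (\<Sum>i\<in>UNIV. f (axis i 1) * x $ i)"
      using bounded_linear.linear[OF linear]
      by (simp add: linear_sum linear_scale mult.commute)
    finally show ?thesis .
  qed
  moreover have "degree_at_most 1 (\<lambda>x. \<Sum>i\<in>UNIV. f (axis i 1) * x $ i)"
    by (intro degree_at_most_sum degree_at_most_cmult degree_at_most_component)
  ultimately show ?case
    by (metis (no_types, lifting) ext)
next
  case (const c)
  then show ?case
    using degree_at_most_const by blast
next
  case (add f g)
  then obtain d e where "degree_at_most d f" "degree_at_most e g"
    by blast
  then have "degree_at_most (max d e) (\<lambda>x. f x + g x)"
    by (intro degree_at_most_add) (auto elim: degree_at_most_mono)
  then show ?case ..
next
  case (mult f g)
  then show ?case
    using degree_at_most_mult by blast
qed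

lemma degree_at_most_poly_degree:
  assumes "real_polynomial_function p" "poly_degree p \<le> d"
  shows "degree_at_most d p"
proof -
  have "degree_at_most (poly_degree p) p"
    using degree_at_most_exists[OF assms(1)] unfolding degree_at_most_def poly_degree_def
    by (rule LeastI_ex)
  then show ?thesis
    using assms(2) by (rule degree_at_most_mono)
qed

section \<open>Sums of squares\<close>

lemma sum_of_squares_add:
  assumes "sum_of_squares p" "sum_of_squares q"
  shows "sum_of_squares (\<lambda>x. p x + q x)"
proof -
  obtain m :: nat and g where g: "\<forall>l<m. real_polynomial_function (g l)"
    "\<forall>x. p x = (\<Sum>l<m. (g l x)\<^sup>2)"
    using assms(1) unfolding sum_of_squares_def by blast
  obtain n :: nat and h where h: "\<forall>l<n. real_polynomial_function (h l)"
    "\<forall>x. q x = (\<Sum>l<n. (h l x)\<^sup>2)"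
    using assms(2) unfolding sum_of_squares_def by blast
  let ?r = "\<lambda>l. if l < m then g l else h (l - m)"
  have "p x + q x = (\<Sum>l<m + n. (?r l x)\<^sup>2)" for x
  proof -
    have "(\<Sum>l<k. (h l x)\<^sup>2) + (\<Sum>l<m. (g l x)\<^sup>2) = (\<Sum>l<m + k. (?r l x)\<^sup>2)" for k
      by (induction k) (auto simp: add.assoc intro!: sum.cong)
    from this[of n] show ?thesis
      using g(2) h(2) by (simp add: add.commute)
  qed
  moreover have "real_polynomial_function (?r l)" if "l < m + n" for l
    using that g h by auto
  ultimately show ?thesis
    unfolding sum_of_squares_def by (intro exI[of _ "m + n"] exI[of _ ?r]) simp
qed

lemma sum_of_squares_square:
  assumes "real_polynomial_function q"
  shows "sum_of_squares (\<lambda>x. (q x)\<^sup>2)"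
  unfolding sum_of_squares_def using assms by (intro exI[of _ 1] exI[of _ "\<lambda>_. q"]) simp

lemma sum_of_squares_const: "0 \<le> c \<Longrightarrow> sum_of_squares (\<lambda>x. c)"
  using sum_of_squares_square[of "\<lambda>x. sqrt c"] by (simp add: real_polynomial_function.intros)

lemma sum_of_squares_cmult:
  assumes "sum_of_squares p" "0 \<le> c"
  shows "sum_of_squares (\<lambda>x. c * p x)"
proof -
  obtain m :: nat and g where g: "\<forall>l<m. real_polynomial_function (g l)"
    "\<forall>x. p x = (\<Sum>l<m. (g l x)\<^sup>2)"
    using assms(1) unfolding sum_of_squares_def by blast
  have "c * p x = (\<Sum>l<m. (sqrt c * g l x)\<^sup>2)" for x
    using assms(2) by (simp add: g power_mult_distrib sum_distrib_left)
  moreover have "real_polynomial_function (\<lambda>x. sqrt c * g l x)" if "l < m" for l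
    using g(1) that by auto
  ultimately show ?thesis
    unfolding sum_of_squares_def by (intro exI[of _ m] exI[of _ "\<lambda>l x. sqrt c * g l x"]) simp
qed

lemma sum_of_squares_sum:
  "(\<And>i. i \<in> I \<Longrightarrow> sum_of_squares (p i)) \<Longrightarrow> sum_of_squares (\<lambda>x. \<Sum>i\<in>I. p i x)"
  by (induction I rule: infinite_finite_induct)
    (simp_all add: sum_of_squares_const sum_of_squares_add)

lemma sum_of_squares_nonneg: "sum_of_squares p \<Longrightarrow> 0 \<le> p x"
  unfolding sum_of_squares_def by (auto simp: sum_nonneg)

text \<open>
  Induction on the size of the matrix by completing the square in the last variable: the Schur
  complement of a positive semidefinite matrix is positive semidefinite. If the last diagonal
  entry vanishes, so does its row, and the division by \<open>0\<close> does no harm.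
\<close>

lemma PSD_quadratic_form_sum_of_squares:
  fixes M :: "nat \<Rightarrow> nat \<Rightarrow> real"
  assumes "\<And>a b. M a b = M b a"
    and "\<And>c. 0 \<le> (\<Sum>a<N. \<Sum>b<N. M a b * c a * c b)"
    and "\<And>a. a < N \<Longrightarrow> real_polynomial_function (g a)"
  shows "sum_of_squares (\<lambda>x. \<Sum>a<N. \<Sum>b<N. M a b * g a x * g b x)"
  using assms
proof (induction N arbitrary: M)
  case 0
  show ?case
    by (simp add: sum_of_squares_const)
next
  case (Suc N)
  define D where "D = M N N"
  define R where "R = (\<lambda>c::nat \<Rightarrow> real. \<Sum>a<N. M a N * c a)"
  define S where "S = (\<lambda>a b. M a b - M a N * M b N / D)"
  have split: "(\<Sum>a<Suc N. \<Sum>b<Suc N. M a b * c a * c b)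
      = (\<Sum>a<N. \<Sum>b<N. M a b * c a * c b) + 2 * R c * c N + D * (c N)\<^sup>2" for c :: "nat \<Rightarrow> real"
  proof -
    have "(\<Sum>b<N. M N b * c N * c b) = R c * c N"
      unfolding R_def sum_distrib_right by (rule sum.cong) (simp_all add: Suc.prems(1)[of N])
    moreover have "(\<Sum>a<N. M a N * c a * c N) = R c * c N"
      unfolding R_def sum_distrib_right ..
    ultimately show ?thesis
      by (simp add: sum.distrib D_def power2_eq_square)
  qed
  have schur: "(\<Sum>a<N. \<Sum>b<N. S a b * c a * c b)
      = (\<Sum>a<N. \<Sum>b<N. M a b * c a * c b) - (R c)\<^sup>2 / D" for c :: "nat \<Rightarrow> real"
  proof -
    have "(R c)\<^sup>2 / D = (\<Sum>a<N. \<Sum>b<N. M a N * M b N / D * c a * c b)"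
      unfolding R_def power2_eq_square sum_product sum_divide_distrib
      by (intro sum.cong refl) (simp add: algebra_simps)
    then show ?thesis
      by (simp add: S_def sum_subtractf left_diff_distrib)
  qed
  \<comment> \<open>Only the last coordinate is varied, which exhibits the form as a quadratic in
    \<open>y\<close> that is never negative.\<close>
  have pos: "0 \<le> (\<Sum>a<N. \<Sum>b<N. M a b * c a * c b) + 2 * R c * y + D * y\<^sup>2" for c :: "nat \<Rightarrow> real" and y
  proof -
    have "R (c(N := y)) = R c"
      unfolding R_def by (rule sum.cong) auto
    moreover have "(\<Sum>a<N. \<Sum>b<N. M a b * (c(N := y)) a * (c(N := y)) b)
        = (\<Sum>a<N. \<Sum>b<N. M a b * c a * c b)"
      by (intro sum.cong) auto
    ultimately show ?thesis
      using Suc.prems(2)[of "c(N := y)"] unfolding split by (simp del: fun_upd_apply) simp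
  qed
  have D: "0 \<le> D"
    using pos[of "\<lambda>_. 0" 1] by (simp add: R_def)
  have R0: "R c = 0" if "D = 0" for c
  proof (rule ccontr)
    assume "R c \<noteq> 0"
    let ?A = "\<Sum>a<N. \<Sum>b<N. M a b * c a * c b"
    \<comment> \<open>For \<open>D = 0\<close> the form is affine in the last variable. With a
      nonzero slope it would reach -1, and it does so at this value.\<close>
    have "0 \<le> ?A + 2 * R c * (- (?A + 1) / (2 * R c))"
      using pos[of c "- (?A + 1) / (2 * R c)"] that by simp
    also have "\<dots> = - 1"
      using \<open>R c \<noteq> 0\<close> by (simp add: field_simps)
    finally show False
      by simp
  qed
  have Spos: "0 \<le> (\<Sum>a<N. \<Sum>b<N. S a b * c a * c b)" for c
  proof (cases "D = 0")
    case True
    then show ?thesis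
      using pos[of c 0] by (simp add: schur)
  next
    case False
    then show ?thesis
      \<comment> \<open>\<open>- R c / D\<close> minimises the quadratic in the last variable, and
        the minimum is the form of the Schur complement.\<close>
      using pos[of c "- R c / D"] unfolding schur by (simp add: power2_eq_square field_simps)
  qed
  have "sum_of_squares (\<lambda>x. \<Sum>a<N. \<Sum>b<N. S a b * g a x * g b x)"
    using Spos Suc.prems(1,3) by (intro Suc.IH) (simp_all add: S_def mult.commute)
  moreover have "sum_of_squares (\<lambda>x. D * (g N x + R (\<lambda>a. g a x) / D)\<^sup>2)"
    unfolding R_def using Suc.prems(3)
    by (intro sum_of_squares_cmult sum_of_squares_square D real_polynomial_function.intros(3)
        real_polynomial_function_divide real_polynomial_function_sum) auto
  ultimately have "sum_of_squares (\<lambda>x. (\<Sum>a<N. \<Sum>b<N. S a b * g a x * g b x)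
      + D * (g N x + R (\<lambda>a. g a x) / D)\<^sup>2)"
    by (rule sum_of_squares_add)
  moreover have "(\<Sum>a<N. \<Sum>b<N. S a b * g a x * g b x) + D * (g N x + R (\<lambda>a. g a x) / D)\<^sup>2
      = (\<Sum>a<Suc N. \<Sum>b<Suc N. M a b * g a x * g b x)" for x
    unfolding split[of "\<lambda>a. g a x"] schur[of "\<lambda>a. g a x"]
    using R0[of "\<lambda>a. g a x"] by (cases "D = 0") (simp_all add: power2_eq_square field_simps)
  ultimately show ?case
    by simp
qed

section \<open>Taylor remainders of SOS-convex polynomials\<close>

text \<open>The coefficients are defined for every index and vanish beyond \<open>N\<close>, so that
  two such sums can be padded to a common length and multiplied by the Cauchy product.\<close>

definition polynomial_in_time :: "('a::real_normed_vector \<Rightarrow> real \<Rightarrow> real) \<Rightarrow> bool" where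
  "polynomial_in_time F \<longleftrightarrow>
     (\<exists>N c. (\<forall>a. real_polynomial_function (c a)) \<and> (\<forall>a>N. \<forall>x. c a x = 0) \<and>
        (\<forall>x t. F x t = (\<Sum>a\<le>N. c a x * t ^ a)))"

lemma polynomial_in_time_coefficient:
  assumes "real_polynomial_function g"
  shows "polynomial_in_time (\<lambda>x t. g x)"
proof -
  have "real_polynomial_function (\<lambda>x. if a = 0 then g x else 0)" for a :: nat
    using assms by (cases "a = 0") (simp_all add: real_polynomial_function.intros(2))
  then show ?thesis
    unfolding polynomial_in_time_def
    by (intro exI[of _ 0] exI[of _ "\<lambda>a x. if a = 0 then g x else 0"]) simp
qed

lemma polynomial_in_time_time: "polynomial_in_time (\<lambda>x t. t)"
  unfolding polynomial_in_time_def
  by (rule exI[of _ 1], rule exI[of _ "\<lambda>a x. if a = 1 then 1 else 0"])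
    (auto simp: real_polynomial_function.intros)

lemma polynomial_in_time_add:
  assumes "polynomial_in_time F" "polynomial_in_time G"
  shows "polynomial_in_time (\<lambda>x t. F x t + G x t)"
proof -
  obtain M c where c: "\<forall>a. real_polynomial_function (c a)" "\<forall>a>M. \<forall>x. c a x = 0"
    "\<forall>x t. F x t = (\<Sum>a\<le>M. c a x * t ^ a)"
    using assms(1) unfolding polynomial_in_time_def by blast
  obtain N d where d: "\<forall>a. real_polynomial_function (d a)" "\<forall>a>N. \<forall>x. d a x = 0"
    "\<forall>x t. G x t = (\<Sum>a\<le>N. d a x * t ^ a)"
    using assms(2) unfolding polynomial_in_time_def by blast
  have "F x t = (\<Sum>a\<le>max M N. c a x * t ^ a)" for x t
    unfolding c(3)[rule_format] using c(2) by (intro sum.mono_neutral_left) auto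
  moreover have "G x t = (\<Sum>a\<le>max M N. d a x * t ^ a)" for x t
    unfolding d(3)[rule_format] using d(2) by (intro sum.mono_neutral_left) auto
  ultimately have "\<forall>x t. F x t + G x t = (\<Sum>a\<le>max M N. (c a x + d a x) * t ^ a)"
    by (simp add: sum.distrib distrib_right)
  then show ?thesis
    unfolding polynomial_in_time_def using c(1,2) d(1,2)
    by (intro exI[of _ "max M N"] exI[of _ "\<lambda>a x. c a x + d a x"])
      (auto intro: real_polynomial_function.intros(3))
qed

lemma polynomial_in_time_mult:
  assumes "polynomial_in_time F" "polynomial_in_time G"
  shows "polynomial_in_time (\<lambda>x t. F x t * G x t)"
proof -
  obtain M c where c: "\<forall>a. real_polynomial_function (c a)" "\<forall>a>M. \<forall>x. c a x = 0"
    "\<forall>x t. F x t = (\<Sum>a\<le>M. c a x * t ^ a)"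
    using assms(1) unfolding polynomial_in_time_def by blast
  obtain N d where d: "\<forall>a. real_polynomial_function (d a)" "\<forall>a>N. \<forall>x. d a x = 0"
    "\<forall>x t. G x t = (\<Sum>a\<le>N. d a x * t ^ a)"
    using assms(2) unfolding polynomial_in_time_def by blast
  let ?e = "\<lambda>a x. \<Sum>k\<le>a. c k x * d (a - k) x"
  have "\<forall>x t. F x t * G x t = (\<Sum>a\<le>M + N. ?e a x * t ^ a)"
    using c(2) d(2) by (simp add: c(3) d(3) polynomial_product)
  moreover have "?e a x = 0" if "a > M + N" for a x
  proof (rule sum.neutral, rule ballI)
    fix k
    show "c k x * d (a - k) x = 0"
      using c(2) d(2) that by (cases "k > M") auto
  qed
  moreover have "real_polynomial_function (?e a)" for a
    using c(1) d(1)
    by (intro real_polynomial_function_sum real_polynomial_function.intros(4)) auto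
  ultimately show ?thesis
    unfolding polynomial_in_time_def by (intro exI[of _ "M + N"] exI[of _ ?e]) auto
qed

lemma polynomial_in_time_sum:
  "(\<And>i. i \<in> I \<Longrightarrow> polynomial_in_time (F i)) \<Longrightarrow> polynomial_in_time (\<lambda>x t. \<Sum>i\<in>I. F i x t)"
  by (induction I rule: infinite_finite_induct)
    (auto intro!: polynomial_in_time_add polynomial_in_time_coefficient
      real_polynomial_function.intros(2))

text \<open>Linear functionals are affine in \<open>t\<close> along the segment, with coefficients
  polynomial in \<open>x\<close>. The other polynomials follow by closure under sums and
  products.\<close>

lemma polynomial_in_time_segment:
  assumes "real_polynomial_function h"
  shows "polynomial_in_time (\<lambda>x t. h (u + t *\<^sub>R (x - u)))"
  using assms
proof (induction rule: real_polynomial_function.induct)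
  case (linear f)
  have "f (u + t *\<^sub>R (x - u)) = f u + t * (f x - f u)" for x t
    using bounded_linear.linear[OF linear] by (simp add: linear_add linear_scale linear_diff)
  moreover have "polynomial_in_time (\<lambda>x t. f u + t * (f x - f u))"
    using linear
    by (intro polynomial_in_time_add polynomial_in_time_mult polynomial_in_time_time
        polynomial_in_time_coefficient real_polynomial_function_diff
        real_polynomial_function.intros(1,2))
  ultimately show ?case
    by simp
next
  case (const c)
  show ?case
    by (intro polynomial_in_time_coefficient real_polynomial_function.intros(2))
qed (intro polynomial_in_time_add polynomial_in_time_mult; assumption)+

section \<open>Taylor remainders of functions of one variable\<close>

text \<open>The value of \<open>\<integral>\<^sub>0\<^sup>1 (1 - t) t\<^sup>a t\<^sup>b dt\<close>, the integral form of the remainder.\<close>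

definition taylor_weight :: "nat \<Rightarrow> nat \<Rightarrow> real" where
  "taylor_weight a b = 1 / (real (a + b + 1) * real (a + b + 2))"

text \<open>The square is expanded and each \<open>t ^ (a + b)\<close> is integrated twice from 0,
  which produces the factor \<open>taylor_weight a b\<close>. Thus \<open>G 1\<close> is the
  integral of (1 - t) times the square over [0, 1], expressed through derivatives alone.\<close>

lemma second_primitive_of_square:
  fixes c :: "nat \<Rightarrow> real"
  shows "\<exists>G G'. (\<forall>t. (G has_real_derivative G' t) (at t)) \<and>
    (\<forall>t. (G' has_real_derivative (\<Sum>a<N. c a * t ^ a)\<^sup>2) (at t)) \<and>
    G 0 = 0 \<and> G' 0 = 0 \<and> G 1 = (\<Sum>a<N. \<Sum>b<N. taylor_weight a b * c a * c b)"
proof -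
  let ?G = "\<lambda>t. \<Sum>a<N. \<Sum>b<N. taylor_weight a b * c a * c b * t ^ (a + b + 2)"
  let ?G' = "\<lambda>t. \<Sum>a<N. \<Sum>b<N. c a * c b / real (a + b + 1) * t ^ (a + b + 1)"
  have "(?G has_real_derivative ?G' t) (at t)" for t
  proof (intro DERIV_sum)
    fix a b
    have "((\<lambda>t. taylor_weight a b * c a * c b * t ^ (a + b + 2)) has_real_derivative
        taylor_weight a b * c a * c b * (real (a + b + 2) * t ^ (a + b + 1))) (at t)"
      by (rule DERIV_cmult, rule DERIV_cong[OF DERIV_pow]) simp
    moreover have "taylor_weight a b * real (a + b + 2) = 1 / real (a + b + 1)"
      unfolding taylor_weight_def by (simp del: of_nat_add of_nat_Suc)
    then have "(taylor_weight a b * real (a + b + 2)) * (c a * c b * t ^ (a + b + 1))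
        = c a * c b / real (a + b + 1) * t ^ (a + b + 1)"
      by simp
    then have "taylor_weight a b * c a * c b * (real (a + b + 2) * t ^ (a + b + 1))
        = c a * c b / real (a + b + 1) * t ^ (a + b + 1)"
      by (simp only: mult_ac)
    ultimately show "((\<lambda>t. taylor_weight a b * c a * c b * t ^ (a + b + 2)) has_real_derivative
        c a * c b / real (a + b + 1) * t ^ (a + b + 1)) (at t)"
      by (simp only:)
  qed
  moreover have "(?G' has_real_derivative (\<Sum>a<N. c a * t ^ a)\<^sup>2) (at t)" for t
    unfolding power2_eq_square sum_product
  proof (intro DERIV_sum)
    fix a b
    have "((\<lambda>t. c a * c b / real (a + b + 1) * t ^ (a + b + 1)) has_real_derivative
        c a * c b / real (a + b + 1) * (real (a + b + 1) * t ^ (a + b))) (at t)"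
      by (rule DERIV_cmult, rule DERIV_cong[OF DERIV_pow]) simp
    then show "((\<lambda>t. c a * c b / real (a + b + 1) * t ^ (a + b + 1)) has_real_derivative
        c a * t ^ a * (c b * t ^ b)) (at t)"
      by (rule DERIV_cong) (simp add: power_add del: of_nat_add of_nat_Suc)
  qed
  ultimately show ?thesis
    by (intro exI[of _ ?G] exI[of _ ?G']) simp
qed

text \<open>The form is the value at 1 of a function that vanishes at 0 together with its first
  derivative and has a square as second derivative.\<close>

lemma taylor_weight_PSD:
  "0 \<le> (\<Sum>a<N. \<Sum>b<N. taylor_weight a b * c a * c b)"
proof -
  obtain G G' where G: "\<forall>t. (G has_real_derivative G' t) (at t)"
    "\<forall>t. (G' has_real_derivative (\<Sum>a<N. c a * t ^ a)\<^sup>2) (at t)"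
    "G 0 = 0" "G' 0 = 0"
    "G 1 = (\<Sum>a<N. \<Sum>b<N. taylor_weight a b * c a * c b)"
    using second_primitive_of_square[of c N] by blast
  have "0 \<le> G' t" if "0 \<le> t" for t
    using DERIV_nonneg_imp_nondecreasing[of 0 t G'] G(2,4) that by (metis zero_le_power2)
  then have "0 \<le> G 1"
    using DERIV_nonneg_imp_nondecreasing[of 0 1 G] G(1,3) by (metis zero_le_one)
  then show ?thesis
    by (simp add: G)
qed

text \<open>Subtracting the double primitives of the squares from \<phi> leaves a function with zero
  second derivative, hence an affine one. Its values at 0 and 1 give the remainder.\<close>

lemma taylor_remainder_sum_of_squares_derivative:
  fixes \<phi> \<phi>' :: "real \<Rightarrow> real"
  assumes "\<And>t. (\<phi> has_real_derivative \<phi>' t) (at t)"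
    and "\<And>t. (\<phi>' has_real_derivative (\<Sum>l<s. (\<Sum>a<N l. c l a * t ^ a)\<^sup>2)) (at t)"
  shows "\<phi> 1 - \<phi> 0 - \<phi>' 0
    = (\<Sum>l<s. \<Sum>a<N l. \<Sum>b<N l. taylor_weight a b * c l a * c l b)"
proof -
  define Q where "Q = (\<lambda>l G G'. (\<forall>t. (G has_real_derivative G' t) (at t)) \<and>
      (\<forall>t. (G' has_real_derivative (\<Sum>a<N l. c l a * t ^ a)\<^sup>2) (at t)) \<and>
      G 0 = 0 \<and> G' 0 = 0 \<and> G 1 = (\<Sum>a<N l. \<Sum>b<N l. taylor_weight a b * c l a * c l b))"
  have "\<forall>l. \<exists>G G'. Q l G G'"
    unfolding Q_def by (intro allI second_primitive_of_square)
  then obtain G G' where "\<And>l. Q l (G l) (G' l)"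
    by metis
  then have G: "\<And>l t. (G l has_real_derivative G' l t) (at t)"
    "\<And>l t. (G' l has_real_derivative (\<Sum>a<N l. c l a * t ^ a)\<^sup>2) (at t)"
    "\<And>l. G l 0 = 0" "\<And>l. G' l 0 = 0"
    "\<And>l. G l 1 = (\<Sum>a<N l. \<Sum>b<N l. taylor_weight a b * c l a * c l b)"
    unfolding Q_def by blast+
  have "((\<lambda>t. \<phi>' t - (\<Sum>l<s. G' l t)) has_real_derivative 0) (at t)" for t
    by (rule DERIV_cong[OF DERIV_diff[OF assms(2) DERIV_sum[OF G(2)]]]) simp
  then have "\<phi>' t - (\<Sum>l<s. G' l t) = \<phi>' 0 - (\<Sum>l<s. G' l 0)" for t
    by (intro DERIV_isconst_all) auto
  then have 1: "\<phi>' t - (\<Sum>l<s. G' l t) = \<phi>' 0" for t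
    by (simp add: G)
  have "((\<lambda>t. \<phi> t - (\<Sum>l<s. G l t) - t * \<phi>' 0) has_real_derivative 0) (at t)" for t
    by (rule DERIV_cong[OF DERIV_diff[OF DERIV_diff[OF assms(1) DERIV_sum[OF G(1)]]
          DERIV_cmult_right[OF DERIV_ident]]]) (simp add: 1)
  then have "\<phi> 1 - (\<Sum>l<s. G l 1) - 1 * \<phi>' 0 = \<phi> 0 - (\<Sum>l<s. G l 0) - 0 * \<phi>' 0"
    by (rule DERIV_isconst_all[rule_format])
  then show ?thesis
    by (simp add: G)
qed

section \<open>First and second derivatives of polynomials along lines\<close>

lemma real_polynomial_function_has_derivative:
  assumes "real_polynomial_function p"
  shows "(p has_derivative frechet_derivative p (at x)) (at x)"
  using assms
proof (induction rule: real_polynomial_function.induct)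
  case (linear f)
  then show ?case
    using frechet_derivative_works differentiable_def bounded_linear_imp_has_derivative by blast
qed (metis differentiable_add differentiable_mult differentiable_const frechet_derivative_works
    differentiable_def)+

text \<open>Makes partial derivatives polynomial again, so that they can be differentiated a second
  time.\<close>

lemma real_polynomial_function_frechet_derivative:
  assumes "real_polynomial_function p"
  shows "real_polynomial_function (\<lambda>x. frechet_derivative p (at x) h)"
  using assms
proof (induction rule: real_polynomial_function.induct)
  case (linear f)
  then have "frechet_derivative f (at x) = f" for x
    by (metis bounded_linear_imp_has_derivative frechet_derivative_at)
  then show ?case
    by (simp add: real_polynomial_function.intros)
next
  case (const c)
  then show ?case
    by (simp add: real_polynomial_function.intros)
next
  case (add f g)
  have "frechet_derivative (\<lambda>x. f x + g x) (at x)
      = (\<lambda>h. frechet_derivative f (at x) h + frechet_derivative g (at x) h)" for x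
    by (intro frechet_derivative_at[symmetric] has_derivative_add
        real_polynomial_function_has_derivative add.hyps)
  then show ?case
    using add.IH by (simp add: real_polynomial_function.intros)
next
  case (mult f g)
  have "frechet_derivative (\<lambda>x. f x * g x) (at x)
      = (\<lambda>h. f x * frechet_derivative g (at x) h + frechet_derivative f (at x) h * g x)" for x
    by (intro frechet_derivative_at[symmetric] has_derivative_mult
        real_polynomial_function_has_derivative mult.hyps)
  then show ?case
    using mult by (simp add: real_polynomial_function.intros)
qed

lemma has_real_derivative_along_line:
  assumes "real_polynomial_function p"
  shows "((\<lambda>t. p (u + t *\<^sub>R h)) has_real_derivative
    frechet_derivative p (at (u + t *\<^sub>R h)) h) (at t)"
proof -
  let ?D = "frechet_derivative p (at (u + t *\<^sub>R h))"
  have D: "(p has_derivative ?D) (at (u + t *\<^sub>R h))"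
    by (rule real_polynomial_function_has_derivative[OF assms])
  have "((\<lambda>t. u + t *\<^sub>R h) has_derivative (\<lambda>r. r *\<^sub>R h)) (at t)"
    by (auto intro!: derivative_eq_intros)
  from has_derivative_compose[OF this D]
  have "((\<lambda>t. p (u + t *\<^sub>R h)) has_derivative (\<lambda>r. ?D (r *\<^sub>R h))) (at t)" .
  moreover have "(\<lambda>r. ?D (r *\<^sub>R h)) = (*) (?D h)"
    using has_derivative_linear[OF D] by (auto simp: linear_scale)
  ultimately show ?thesis
    by (simp add: has_field_derivative_def)
qed

lemma frechet_derivative_eq_sum_partial_deriv:
  assumes "real_polynomial_function p"
  shows "frechet_derivative p (at x) h = (\<Sum>j\<in>UNIV. h $ j * partial_deriv j p x)"
proof -
  let ?D = "frechet_derivative p (at x)"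
  have D: "linear ?D"
    by (rule has_derivative_linear[OF real_polynomial_function_has_derivative[OF assms]])
  have "?D h = ?D (\<Sum>i\<in>UNIV. h $ i *\<^sub>R axis i 1)"
    by (simp add: basis_expansion[of h, unfolded scalar_mult_eq_scaleR])
  also have "\<dots> = (\<Sum>j\<in>UNIV. h $ j * partial_deriv j p x)"
    using D by (simp add: linear_sum linear_scale partial_deriv_def)
  finally show ?thesis .
qed

text \<open>The first derivative along the line is a combination of partial derivatives with
  constant coefficients. Differentiating each of them along the same line yields the quadratic form
  of the Hessian in the direction \<open>h\<close>.\<close>

lemma has_real_derivative_along_line_second:
  fixes p :: "real^'n::finite \<Rightarrow> real"
  assumes "real_polynomial_function p"
  shows "((\<lambda>t. frechet_derivative p (at (u + t *\<^sub>R h)) h) has_real_derivative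
    (\<Sum>j\<in>UNIV. \<Sum>i\<in>UNIV. h $ j * (h $ i * hessian p (u + t *\<^sub>R h) $ i $ j))) (at t)"
proof -
  have "((\<lambda>t. \<Sum>j\<in>UNIV. h $ j * partial_deriv j p (u + t *\<^sub>R h)) has_real_derivative
    (\<Sum>j\<in>UNIV. h $ j * (\<Sum>i\<in>UNIV. h $ i * hessian p (u + t *\<^sub>R h) $ i $ j))) (at t)"
  proof (intro DERIV_sum DERIV_cmult)
    fix j :: 'n
    have "real_polynomial_function (partial_deriv j p)"
      unfolding partial_deriv_def
      by (rule real_polynomial_function_frechet_derivative[OF assms])
    from has_real_derivative_along_line[OF this, of u h t]
    show "((\<lambda>t. partial_deriv j p (u + t *\<^sub>R h)) has_real_derivative
        (\<Sum>i\<in>UNIV. h $ i * hessian p (u + t *\<^sub>R h) $ i $ j)) (at t)"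
      unfolding frechet_derivative_eq_sum_partial_deriv[OF
          \<open>real_polynomial_function (partial_deriv j p)\<close>]
      by (simp add: hessian_def)
  qed
  then show ?thesis
    by (simp add: frechet_derivative_eq_sum_partial_deriv[OF assms] sum_distrib_left)
qed

section \<open>Polynomials whose first-order Taylor remainders are sums of squares\<close>

text \<open>The consequence of SOS-convexity on which everything later rests. It passes to
  nonnegative combinations without computing Hessians of sums, and it implies convexity.\<close>

definition taylor_SOS :: "(real^'n::finite \<Rightarrow> real) \<Rightarrow> bool" where
  "taylor_SOS p \<longleftrightarrow> real_polynomial_function p \<and>
     (\<forall>u. \<exists>D. (p has_derivative D) (at u) \<and> sum_of_squares (\<lambda>x. p x - p u - D (x - u)))"

lemma taylor_SOSE:
  assumes "taylor_SOS p"
  obtains D where "(p has_derivative D) (at u)" "sum_of_squares (\<lambda>x. p x - p u - D (x - u))"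
  using assms unfolding taylor_SOS_def by blast

text \<open>The factorisation of the Hessian makes the second derivative along the segment a sum of
  squares of polynomials in \<open>t\<close>. The remainder is then a sum over \<open>l\<close> of
  the quadratic forms of \<open>taylor_weight\<close> in their coefficients, which are polynomials
  in \<open>x\<close>.\<close>

lemma SOS_convex_imp_taylor_SOS:
  fixes p :: "real^'n::finite \<Rightarrow> real"
  assumes "SOS_convex p"
  shows "taylor_SOS p"
  unfolding taylor_SOS_def
proof (intro conjI allI)
  show p: "real_polynomial_function p"
    using assms by (simp add: SOS_convex_def)
  fix u
  obtain s :: nat and H where H: "\<forall>i. \<forall>l<s. real_polynomial_function (H i l)"
    and hess: "\<forall>x i j. hessian p x $ i $ j = (\<Sum>l<s. H i l x * H j l x)"
    using assms unfolding SOS_convex_def SOS_matrix_polynomial_def by blast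
  \<comment> \<open>The \<open>l\<close>-th entry of the transpose of \<open>H\<close>, taken at the
    point with parameter \<open>t\<close> on the segment, applied to \<open>x - u\<close>.\<close>
  define F where "F = (\<lambda>l x t. \<Sum>i\<in>UNIV. (x - u) $ i * H i l (u + t *\<^sub>R (x - u)))"
  have "real_polynomial_function (\<lambda>x. (x - u) $ i)" for i
    unfolding vector_minus_component
    by (intro real_polynomial_function_diff real_polynomial_function.intros(2)
        real_polynomial_function.intros(1)[OF bounded_linear_vec_nth])
  then have "polynomial_in_time (F l)" if "l < s" for l
    unfolding F_def using H that
    by (intro polynomial_in_time_sum polynomial_in_time_mult polynomial_in_time_coefficient
        polynomial_in_time_segment) auto
  moreover define Q where "Q = (\<lambda>l N c. (\<forall>a. real_polynomial_function (c a)) \<and>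
      (\<forall>x t. F l x t = (\<Sum>a\<le>N. c a x * t ^ a)))"
  ultimately have "\<exists>N c. Q l N c" if "l < s" for l
    unfolding polynomial_in_time_def using that by blast
  then obtain N c where "\<And>l. l < s \<Longrightarrow> Q l (N l) (c l)"
    by metis
  then have c: "\<And>l a. l < s \<Longrightarrow> real_polynomial_function (c l a)"
    and F: "\<And>l x t. l < s \<Longrightarrow> F l x t = (\<Sum>a\<le>N l. c l a x * t ^ a)"
    unfolding Q_def by blast+
  have "p x - p u - frechet_derivative p (at u) (x - u)
      = (\<Sum>l<s. \<Sum>a<Suc (N l). \<Sum>b<Suc (N l). taylor_weight a b * c l a x * c l b x)" for x
  proof -
    let ?h = "x - u"
    have *: "(\<Sum>j\<in>UNIV. \<Sum>i\<in>UNIV. ?h $ j * (?h $ i * hessian p (u + t *\<^sub>R ?h) $ i $ j))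
        = (\<Sum>l<s. (\<Sum>a<Suc (N l). c l a x * t ^ a)\<^sup>2)" for t
    proof -
      have "(\<Sum>j\<in>UNIV. \<Sum>i\<in>UNIV. ?h $ j * (?h $ i * hessian p (u + t *\<^sub>R ?h) $ i $ j))
          = (\<Sum>j\<in>UNIV. \<Sum>i\<in>UNIV. \<Sum>l<s. (?h $ j * H j l (u + t *\<^sub>R ?h)) * (?h $ i * H i l (u + t *\<^sub>R ?h)))"
        unfolding hess[rule_format] sum_distrib_left by (intro sum.cong refl) (simp add: algebra_simps)
      also have "\<dots> = (\<Sum>j\<in>UNIV. \<Sum>l<s. \<Sum>i\<in>UNIV. (?h $ j * H j l (u + t *\<^sub>R ?h)) * (?h $ i * H i l (u + t *\<^sub>R ?h)))"
        by (intro sum.cong refl sum.swap)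
      also have "\<dots> = (\<Sum>l<s. \<Sum>j\<in>UNIV. \<Sum>i\<in>UNIV. (?h $ j * H j l (u + t *\<^sub>R ?h)) * (?h $ i * H i l (u + t *\<^sub>R ?h)))"
        by (rule sum.swap)
      also have "\<dots> = (\<Sum>l<s. (F l x t)\<^sup>2)"
        by (simp only: F_def power2_eq_square sum_product)
      also have "\<dots> = (\<Sum>l<s. (\<Sum>a<Suc (N l). c l a x * t ^ a)\<^sup>2)"
        by (intro sum.cong refl) (simp only: F lessThan_iff lessThan_Suc_atMost)
      finally show ?thesis .
    qed
    from taylor_remainder_sum_of_squares_derivative[where c = "\<lambda>l a. c l a x" and N = "\<lambda>l. Suc (N l)",
        OF has_real_derivative_along_line[OF p]
           has_real_derivative_along_line_second[OF p, of u ?h, unfolded *]]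
    show ?thesis
      by (simp del: sum.lessThan_Suc)
  qed
  \<comment> \<open>The weight matrix is constant and positive semidefinite; only the arguments of
    the forms depend on \<open>x\<close>.\<close>
  moreover have "sum_of_squares (\<lambda>x. \<Sum>l<s. \<Sum>a<Suc (N l). \<Sum>b<Suc (N l).
      taylor_weight a b * c l a x * c l b x)"
    by (intro sum_of_squares_sum PSD_quadratic_form_sum_of_squares taylor_weight_PSD c)
      (simp_all add: taylor_weight_def add.commute)
  ultimately have "sum_of_squares (\<lambda>x. p x - p u - frechet_derivative p (at u) (x - u))"
    by presburger
  then show "\<exists>D. (p has_derivative D) (at u) \<and> sum_of_squares (\<lambda>x. p x - p u - D (x - u))"
    using real_polynomial_function_has_derivative[OF p] by blast
qed

lemma taylor_SOS_add:
  assumes "taylor_SOS p" "taylor_SOS q"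
  shows "taylor_SOS (\<lambda>x. p x + q x)"
  unfolding taylor_SOS_def
proof (intro conjI allI)
  show "real_polynomial_function (\<lambda>x. p x + q x)"
    using assms by (simp add: taylor_SOS_def real_polynomial_function.intros)
  fix u
  obtain D where D: "(p has_derivative D) (at u)" "sum_of_squares (\<lambda>x. p x - p u - D (x - u))"
    by (rule taylor_SOSE[OF assms(1)])
  obtain E where E: "(q has_derivative E) (at u)" "sum_of_squares (\<lambda>x. q x - q u - E (x - u))"
    by (rule taylor_SOSE[OF assms(2)])
  have "sum_of_squares (\<lambda>x. p x + q x - (p u + q u) - (D (x - u) + E (x - u)))"
    using sum_of_squares_add[OF D(2) E(2)] by (simp add: algebra_simps)
  then show "\<exists>D. ((\<lambda>x. p x + q x) has_derivative D) (at u) \<and>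
      sum_of_squares (\<lambda>x. p x + q x - (p u + q u) - D (x - u))"
    using has_derivative_add[OF D(1) E(1)] by (intro exI[of _ "\<lambda>h. D h + E h"]) simp
qed

lemma taylor_SOS_cmult:
  assumes "taylor_SOS p" "0 \<le> a"
  shows "taylor_SOS (\<lambda>x. a * p x)"
  unfolding taylor_SOS_def
proof (intro conjI allI)
  show "real_polynomial_function (\<lambda>x. a * p x)"
    using assms by (simp add: taylor_SOS_def real_polynomial_function.intros)
  fix u
  obtain D where D: "(p has_derivative D) (at u)" "sum_of_squares (\<lambda>x. p x - p u - D (x - u))"
    by (rule taylor_SOSE[OF assms(1)])
  have "sum_of_squares (\<lambda>x. a * p x - a * p u - a * D (x - u))"
    using sum_of_squares_cmult[OF D(2) assms(2)] by (simp add: algebra_simps)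
  then show "\<exists>D. ((\<lambda>x. a * p x) has_derivative D) (at u) \<and>
      sum_of_squares (\<lambda>x. a * p x - a * p u - D (x - u))"
    using has_derivative_mult_right[OF D(1), of a] by (intro exI[of _ "\<lambda>h. a * D h"]) simp
qed

lemma taylor_SOS_const: "taylor_SOS (\<lambda>x. a)"
  unfolding taylor_SOS_def
  by (auto intro!: real_polynomial_function.intros(2) exI[of _ "\<lambda>h. 0"] simp: sum_of_squares_const)

lemma taylor_SOS_sum:
  "(\<And>i. i \<in> I \<Longrightarrow> taylor_SOS (p i)) \<Longrightarrow> taylor_SOS (\<lambda>x. \<Sum>i\<in>I. p i x)"
  by (induction I rule: infinite_finite_induct) (simp_all add: taylor_SOS_const taylor_SOS_add)

text \<open>A sum of squares is nonnegative, so \<open>p\<close> lies above its tangent at the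
  intermediate point \<open>?u\<close>. Averaging the tangent bounds at \<open>x\<close> and
  \<open>y\<close> cancels the linear terms, because the weighted displacements from
  \<open>?u\<close> add up to 0.\<close>

lemma taylor_SOS_imp_convex_on:
  fixes p :: "real^'n::finite \<Rightarrow> real"
  assumes "taylor_SOS p"
  shows "convex_on UNIV p"
proof (rule convex_onI)
  fix t :: real and x y :: "real^'n"
  assume t: "0 < t" "t < 1"
  let ?u = "(1 - t) *\<^sub>R x + t *\<^sub>R y"
  obtain D where D: "(p has_derivative D) (at ?u)" "sum_of_squares (\<lambda>x. p x - p ?u - D (x - ?u))"
    by (rule taylor_SOSE[OF assms(1)])
  have lin: "linear D"
    by (rule has_derivative_linear[OF D(1)])
  have above: "p z \<ge> p ?u + D (z - ?u)" for z
    using sum_of_squares_nonneg[OF D(2), of z] by simp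
  have "(1 - t) * D (x - ?u) + t * D (y - ?u) = D ((1 - t) *\<^sub>R (x - ?u) + t *\<^sub>R (y - ?u))"
    using lin by (simp only: linear_add linear_scale real_scaleR_def)
  also have "(1 - t) *\<^sub>R (x - ?u) + t *\<^sub>R (y - ?u) = 0"
    by (simp add: algebra_simps)
  finally have "(1 - t) * D (x - ?u) + t * D (y - ?u) = 0"
    using lin by (simp add: linear_0)
  moreover have "(1 - t) * (p ?u + D (x - ?u)) + t * (p ?u + D (y - ?u)) \<le> (1 - t) * p x + t * p y"
    using t above by (intro add_mono mult_left_mono) auto
  ultimately show "p ?u \<le> (1 - t) * p x + t * p y"
    by (simp add: algebra_simps)
qed simp

text \<open>The derivative vanishes at a minimiser, so \<open>p\<close> is its Taylor remainder
  there plus the nonnegative constant \<open>p u\<close>.\<close>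

lemma taylor_SOS_at_minimum:
  assumes "taylor_SOS p" "\<And>x. p u \<le> p x" "0 \<le> p u"
  shows "sum_of_squares p"
proof -
  obtain D where D: "(p has_derivative D) (at u)" "sum_of_squares (\<lambda>x. p x - p u - D (x - u))"
    by (rule taylor_SOSE[OF assms(1)])
  have "D = (\<lambda>h. 0)"
    using has_derivative_local_min[OF D(1)] assms(2) by simp
  then have "sum_of_squares (\<lambda>x. (p x - p u) + p u)"
    using D(2) assms(3) by (intro sum_of_squares_add sum_of_squares_const) simp_all
  then show ?thesis
    by simp
qed

section \<open>Convex polynomials attain their infimum\<close>

text \<open>A nonzero coefficient of positive index would make the absolute value of
  \<open>f\<close> exceed \<open>B\<close> at every point of large norm, in particular at positive
  ones.\<close>

lemma real_polynomial_function_bounded_imp_const: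
  fixes f :: "real \<Rightarrow> real"
  assumes "real_polynomial_function f" and "\<And>t. 0 \<le> t \<Longrightarrow> \<bar>f t\<bar> \<le> B"
  shows "f t = f 0"
proof -
  obtain a n where f: "f = (\<lambda>x. \<Sum>i\<le>n. a i * x ^ i)"
    using real_polynomial_function_imp_sum[OF assms(1)] by blast
  have "a i = 0" if "i \<in> {1..n}" for i
  proof (rule ccontr)
    assume "a i \<noteq> 0"
    then have "eventually (\<lambda>t. norm (\<Sum>i\<le>n. a i * t ^ i) \<ge> B + 1) at_infinity"
      using that by (intro polyfun_extremal exI[of _ i]) auto
    then obtain b where "\<forall>t. b \<le> norm t \<longrightarrow> norm (f t) \<ge> B + 1"
      unfolding eventually_at_infinity f by blast
    then have "\<bar>f \<bar>b\<bar>\<bar> \<ge> B + 1"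
      by simp
    then show False
      using assms(2)[of "\<bar>b\<bar>"] by simp
  qed
  then have "f x = (\<Sum>i\<in>{0}. a i * x ^ i)" for x
    unfolding f by (intro sum.mono_neutral_right) auto
  then show ?thesis
    by simp
qed

text \<open>
  An unbounded sequence in a sublevel set yields a direction of recession \<open>w\<close>; along \<open>w\<close> the
  polynomial is bounded on half-lines, hence constant on lines. So sublevel sets are bounded on
  the orthogonal complement of the space of such constancy directions.
\<close>

lemma convex_polynomial_recession_direction:
  fixes p :: "'a::euclidean_space \<Rightarrow> real"
  assumes p: "real_polynomial_function p" and conv: "convex_on UNIV p" and below: "\<And>x. B \<le> p x"
    and X: "\<And>k. p (X k) \<le> c"
    and inf: "filterlim (\<lambda>k. norm (X k)) at_top sequentially"
    and w: "(\<lambda>k. X k /\<^sub>R norm (X k)) \<longlonglongrightarrow> w"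
  shows "p (x + t *\<^sub>R w) = p x"
proof -
  define C where "C = max (p x) c"
  have cont: "isCont p y" for y
    by (rule continuous_real_polymonial_function[OF p])
  have upper: "p (x + t *\<^sub>R w) \<le> C" if "0 \<le> t" for t
  proof (rule LIMSEQ_le_const2)
    \<comment> \<open>This is the point at fraction \<open>t / norm (X k)\<close> of the way from
      \<open>x\<close> to \<open>X k\<close>, written so that its limit can be read off. Convexity
      bounds \<open>p\<close> there by \<open>C\<close>, which dominates \<open>p\<close> at both
      ends.\<close>
    let ?Y = "\<lambda>k. x + (t *\<^sub>R (X k /\<^sub>R norm (X k)) - (t / norm (X k)) *\<^sub>R x)"
    have "(\<lambda>k. t / norm (X k)) \<longlonglongrightarrow> 0"
      using inf by (intro real_tendsto_divide_at_top[of _ t]) auto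
    then have "?Y \<longlonglongrightarrow> x + (t *\<^sub>R w - 0 *\<^sub>R x)"
      using w by (intro tendsto_intros)
    then have "?Y \<longlonglongrightarrow> x + t *\<^sub>R w"
      by simp
    then show "(\<lambda>k. p (?Y k)) \<longlonglongrightarrow> p (x + t *\<^sub>R w)"
      by (rule isCont_tendsto_compose[OF cont])
    \<comment> \<open>Bound 1 keeps the denominator positive, and bound \<open>t\<close> keeps the
      fraction at most 1.\<close>
    have "eventually (\<lambda>k. max t 1 \<le> norm (X k)) sequentially"
      using inf unfolding filterlim_at_top by blast
    then show "\<exists>N. \<forall>k\<ge>N. p (?Y k) \<le> C"
      unfolding eventually_sequentially
    proof (elim exE, intro exI allI impI)
      fix N k
      assume "\<forall>k\<ge>N. max t 1 \<le> norm (X k)" "N \<le> k"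
      then have k: "t \<le> norm (X k)" "1 \<le> norm (X k)"
        by auto
      let ?s = "t / norm (X k)"
      have s: "0 \<le> ?s" "?s \<le> 1"
        using k that by (auto simp: divide_le_eq)
      have "?Y k = (1 - ?s) *\<^sub>R x + ?s *\<^sub>R X k"
        by (simp add: scaleR_left_diff_distrib divide_inverse)
      then have "p (?Y k) \<le> (1 - ?s) * p x + ?s * p (X k)"
        using convex_onD[OF conv s, of x "X k"] by simp
      also have "\<dots> \<le> (1 - ?s) * C + ?s * C"
        using s X[of k] by (intro add_mono mult_left_mono) (auto simp: C_def)
      finally show "p (?Y k) \<le> C"
        by (simp add: algebra_simps)
    qed
  qed
  have "polynomial_function (\<lambda>t. x + t *\<^sub>R w)"
    by (intro polynomial_function_add polynomial_function_const
        polynomial_function_bounded_linear bounded_linear_scaleR_left)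
  then have "real_polynomial_function (\<lambda>t. p (x + t *\<^sub>R w))"
    using real_polynomial_function_compose[OF _ p] by (simp add: o_def)
  moreover have "\<bar>p (x + t *\<^sub>R w)\<bar> \<le> \<bar>B\<bar> + \<bar>C\<bar>" if "0 \<le> t" for t
    using upper[OF that] below[of "x + t *\<^sub>R w"] by linarith
  ultimately have "p (x + t *\<^sub>R w) = p (x + 0 *\<^sub>R w)"
    by (rule real_polynomial_function_bounded_imp_const)
  then show ?thesis
    by simp
qed

text \<open>Projecting a point onto the orthogonal complement \<open>S\<close> of the constancy
  space \<open>L\<close> does not change \<open>p\<close>, so it suffices to minimise over
  \<open>S\<close>. There the sublevel set \<open>K\<close> is compact and contains 0.\<close>

lemma convex_polynomial_attains_minimum:
  fixes p :: "'a::euclidean_space \<Rightarrow> real"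
  assumes p: "real_polynomial_function p" and conv: "convex_on UNIV p" and below: "\<And>x. B \<le> p x"
  obtains u where "\<And>x. p u \<le> p x"
proof -
  define L where "L = {w. \<forall>x t. p (x + t *\<^sub>R w) = p x}"
  define S where "S = {z. \<forall>w\<in>L. orthogonal w z}"
  define K where "K = S \<inter> {x. p x \<le> p 0}"
  have "subspace L"
    unfolding subspace_def L_def
  proof (intro conjI allI ballI impI)
    show "0 \<in> {w. \<forall>x t. p (x + t *\<^sub>R w) = p x}"
      by simp
    fix v w
    assume "v \<in> {w. \<forall>x t. p (x + t *\<^sub>R w) = p x}" "w \<in> {w. \<forall>x t. p (x + t *\<^sub>R w) = p x}"
    then show "v + w \<in> {w. \<forall>x t. p (x + t *\<^sub>R w) = p x}"
      by (simp add: scaleR_right_distrib flip: add.assoc)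
  next
    fix a v
    assume "v \<in> {w. \<forall>x t. p (x + t *\<^sub>R w) = p x}"
    then show "a *\<^sub>R v \<in> {w. \<forall>x t. p (x + t *\<^sub>R w) = p x}"
      by simp
  qed
  have "subspace S"
    unfolding S_def by (rule subspace_orthogonal_to_vectors)
  have "continuous_on UNIV p"
    using continuous_real_polymonial_function[OF p] by (simp add: continuous_on_eq_continuous_at)
  have "closed K"
    unfolding K_def
    by (intro closed_Int closed_subspace \<open>subspace S\<close> closed_Collect_le continuous_on_const
        \<open>continuous_on UNIV p\<close>)
  have "bounded K"
  proof (rule ccontr)
    assume "\<not> bounded K"
    then have "\<forall>k. \<exists>x\<in>K. real k < norm x"
      unfolding bounded_iff by (meson not_le)
    then obtain X where X: "\<And>k. X k \<in> K" "\<And>k. real k < norm (X k)"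
      by metis
    \<comment> \<open>The directions lie in the compact unit sphere of \<open>S\<close>. A limit
      direction \<open>w\<close> is a unit vector of \<open>S\<close> that also belongs to
      \<open>L\<close>, hence is orthogonal to itself, which is impossible.\<close>
    let ?d = "\<lambda>k. X k /\<^sub>R norm (X k)"
    have "X k \<noteq> 0" for k
      using X(2)[of k] by auto
    then have "\<forall>k. ?d k \<in> sphere 0 1 \<inter> S"
      using X(1) \<open>subspace S\<close> by (auto simp: K_def subspace_scale)
    moreover have "compact (sphere 0 1 \<inter> S)"
      by (intro compact_Int_closed compact_sphere closed_subspace \<open>subspace S\<close>)
    ultimately obtain w r where w: "w \<in> sphere 0 1 \<inter> S" and r: "strict_mono (r :: nat \<Rightarrow> nat)"
      and lim: "(?d \<circ> r) \<longlonglongrightarrow> w"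
      unfolding compact_def by meson
    have "filterlim (\<lambda>k. norm (X k)) at_top sequentially"
      by (rule filterlim_at_top_mono[OF filterlim_real_sequentially])
        (use X(2) in \<open>auto intro: always_eventually less_imp_le\<close>)
    then have "filterlim (\<lambda>k. norm (X (r k))) at_top sequentially"
      by (rule filterlim_compose[OF _ filterlim_subseq[OF r]])
    moreover have "p (X (r k)) \<le> p 0" for k
      using X(1) by (simp add: K_def)
    ultimately have "p (x + t *\<^sub>R w) = p x" for x t
      using lim by (intro convex_polynomial_recession_direction[OF p conv below, where X = "X \<circ> r"])
        (auto simp: o_def)
    then have "w \<in> L"
      by (simp add: L_def)
    then show False
      using w by (auto simp: S_def orthogonal_self)
  qed
  with \<open>closed K\<close> have "compact K"
    by (simp add: compact_eq_bounded_closed)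
  moreover have "0 \<in> K"
    using \<open>subspace S\<close> by (simp add: K_def subspace_0)
  ultimately obtain u where "u \<in> K" and u: "\<forall>y\<in>K. p u \<le> p y"
    using continuous_attains_inf[of K p] continuous_on_subset[OF \<open>continuous_on UNIV p\<close>] by blast
  have "p u \<le> p x" for x
  proof -
    obtain y z where y: "y \<in> span L" and z: "\<And>w. w \<in> span L \<Longrightarrow> orthogonal z w" and x: "x = y + z"
      using orthogonal_subspace_decomp_exists[of L x] by blast
    have "y \<in> L"
      using y \<open>subspace L\<close> by (metis span_eq_iff)
    then have "p (z + 1 *\<^sub>R y) = p z"
      unfolding L_def by blast
    then have "p x = p z"
      by (simp add: x add.commute)
    have "z \<in> S"
      using z by (auto simp: S_def orthogonal_commute span_base)
    show ?thesis
    proof (cases "p z \<le> p 0")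
      case True
      with \<open>z \<in> S\<close> have "z \<in> K"
        by (simp add: K_def)
      then show ?thesis
        using u \<open>p x = p z\<close> by simp
    next
      case False
      moreover have "p u \<le> p 0"
        using u \<open>0 \<in> K\<close> by blast
      ultimately show ?thesis
        using \<open>p x = p z\<close> by simp
    qed
  qed
  then show ?thesis
    by (rule that)
qed

lemma nonneg_taylor_SOS_imp_sum_of_squares:
  assumes "taylor_SOS p" "\<And>x. 0 \<le> p x"
  shows "sum_of_squares p"
proof -
  have "real_polynomial_function p"
    using assms(1) by (simp add: taylor_SOS_def)
  then obtain u where "\<And>x. p u \<le> p x"
    using convex_polynomial_attains_minimum taylor_SOS_imp_convex_on[OF assms(1)] assms(2) by metis
  then show ?thesis
    using taylor_SOS_at_minimum assms by metis
qed

section \<open>A theorem of the alternative for convex functions\<close>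

text \<open>Points with \<open>F y > 0\<close> bound \<kappa> below by \<open>- G y / F y\<close>,
  and points with \<open>F x < 0\<close> bound it above by \<open>G x / - F x\<close>. Convexity
  makes every lower bound at most every upper bound, so the supremum of the lower bounds
  works.\<close>

lemma convex_nonneg_multiplier:
  fixes F G :: "'a::real_vector \<Rightarrow> real"
  assumes F: "convex_on C F" and G: "convex_on C G"
    and x0: "x0 \<in> C" "F x0 < 0" and nonneg: "\<And>x. x \<in> C \<Longrightarrow> F x < 0 \<Longrightarrow> 0 \<le> G x"
  shows "\<exists>\<kappa>\<ge>0. \<forall>x\<in>C. 0 \<le> \<kappa> * F x + G x"
proof -
  have "convex C"
    using F by (simp add: convex_on_def)
  have boundary: "0 \<le> G x" if "x \<in> C" "F x \<le> 0" for x
  proof (rule tendsto_lowerbound[where F = "at_right 0"])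
    \<comment> \<open>Moving slightly from \<open>x\<close> towards \<open>x0\<close> makes
      \<open>F\<close> strictly negative and hence \<open>G\<close> nonnegative. The chord bound for
      \<open>G\<close> tends to \<open>G x\<close>.\<close>
    have "((\<lambda>e. (1 - e) * G x + e * G x0) \<longlongrightarrow> (1 - 0) * G x + 0 * G x0) (at_right 0)"
      by (intro tendsto_intros)
    then show "((\<lambda>e. (1 - e) * G x + e * G x0) \<longlongrightarrow> G x) (at_right 0)"
      by simp
    have "eventually (\<lambda>e::real. 0 < e \<and> e < 1) (at_right 0)"
      unfolding eventually_at_right_field by (intro exI[of _ 1]) auto
    then show "eventually (\<lambda>e. 0 \<le> (1 - e) * G x + e * G x0) (at_right 0)"
    proof eventually_elim
      case (elim e)
      let ?z = "(1 - e) *\<^sub>R x + e *\<^sub>R x0"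
      have "F ?z \<le> (1 - e) * F x + e * F x0"
        using elim that x0 by (intro convex_onD[OF F]) auto
      also have "\<dots> < 0"
        using elim that(2) x0(2)
        by (intro add_nonpos_neg mult_nonneg_nonpos mult_pos_neg) auto
      finally have "0 \<le> G ?z"
        using elim that x0 \<open>convex C\<close> by (intro nonneg) (auto intro: convexD_alt)
      also have "\<dots> \<le> (1 - e) * G x + e * G x0"
        using elim that x0 by (intro convex_onD[OF G]) auto
      finally show ?case .
    qed
  qed simp
  have cross: "- G y / F y \<le> G x / - F x" if "x \<in> C" "F x < 0" "y \<in> C" "0 < F y" for x y
  proof -
    \<comment> \<open>The parameter at which the chord of \<open>F\<close> from \<open>x\<close> to
      \<open>y\<close> crosses 0, so that \<open>boundary\<close> applies to the corresponding
      point.\<close>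
    define e where "e = - F x / (F y - F x)"
    have e: "0 \<le> e" "e \<le> 1" "1 - e = F y / (F y - F x)"
      using that by (auto simp: e_def field_simps)
    let ?z = "(1 - e) *\<^sub>R x + e *\<^sub>R y"
    have "F ?z \<le> (1 - e) * F x + e * F y"
      using e that by (intro convex_onD[OF F])
    also have "\<dots> = 0"
      using that unfolding e(3) by (simp add: e_def field_simps)
    finally have "0 \<le> G ?z"
      using convexD_alt[OF \<open>convex C\<close> \<open>x \<in> C\<close> \<open>y \<in> C\<close>] e(1,2) by (intro boundary)
    also have "\<dots> \<le> (1 - e) * G x + e * G y"
      using e that by (intro convex_onD[OF G])
    also have "\<dots> = (F y * G x - F x * G y) / (F y - F x)"
      unfolding e(3) by (simp add: e_def diff_divide_distrib)
    finally have "0 \<le> F y * G x - F x * G y"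
      using that by (simp add: zero_le_divide_iff)
    then show ?thesis
      using that by (simp add: field_simps)
  qed
  \<comment> \<open>The element 0 forces \<open>0 \<le> \<kappa>\<close> and keeps \<open>A\<close>
    nonempty when \<open>F\<close> is never positive; \<open>x0\<close> supplies an upper
    bound.\<close>
  define A where "A = insert 0 ((\<lambda>y. - G y / F y) ` {y \<in> C. 0 < F y})"
  define \<kappa> where "\<kappa> = Sup A"
  have upper: "a \<le> G x / - F x" if "a \<in> A" "x \<in> C" "F x < 0" for a x
    using that cross nonneg[of x] unfolding A_def by (auto simp: divide_nonneg_neg)
  then have bdd: "bdd_above A"
    using x0 by (intro bdd_aboveI)
  show ?thesis
  proof (intro exI[of _ \<kappa>] conjI ballI)
    show "0 \<le> \<kappa>"
      unfolding \<kappa>_def by (rule cSup_upper[OF _ bdd]) (simp add: A_def)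
    fix x
    assume "x \<in> C"
    consider "F x < 0" | "F x = 0" | "0 < F x"
      by linarith
    then show "0 \<le> \<kappa> * F x + G x"
    proof cases
      case 1
      then have "\<kappa> \<le> G x / - F x"
        unfolding \<kappa>_def using upper \<open>x \<in> C\<close> by (intro cSup_least) (auto simp: A_def)
      with 1 show ?thesis
        by (simp add: field_simps)
    next
      case 2
      then show ?thesis
        using boundary \<open>x \<in> C\<close> by simp
    next
      case 3
      then have "- G x / F x \<le> \<kappa>"
        unfolding \<kappa>_def using \<open>x \<in> C\<close> by (intro cSup_upper[OF _ bdd]) (auto simp: A_def)
      with 3 show ?thesis
        by (simp add: field_simps)
    qed
  qed
qed

lemma convex_sublevel:
  fixes F :: "'a::real_vector \<Rightarrow> real"
  assumes "convex_on C F"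
  shows "convex {x \<in> C. F x < c}"
proof (rule convexI)
  fix x y and a b :: real
  assume xy: "x \<in> {x \<in> C. F x < c}" "y \<in> {x \<in> C. F x < c}" and ab: "0 \<le> a" "0 \<le> b" "a + b = 1"
  have "F (a *\<^sub>R x + b *\<^sub>R y) \<le> a * F x + b * F y" "a *\<^sub>R x + b *\<^sub>R y \<in> C"
    using assms xy ab unfolding convex_on_def convex_def by auto
  moreover have "a * F x + b * F y < c"
    using convex_bound_lt[of "F x" c "F y" a b] xy ab by simp
  ultimately show "a *\<^sub>R x + b *\<^sub>R y \<in> {x \<in> C. F x < c}"
    by simp
qed

lemma convex_on_finite_sum:
  assumes "convex C" "\<And>i. i \<in> I \<Longrightarrow> convex_on C (F i)"
  shows "convex_on C (\<lambda>x. \<Sum>i\<in>I. F i x :: real)"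
  using assms by (induction I rule: infinite_finite_induct) (simp_all add: convex_on_add convex_on_const)

text \<open>
  Induction on the number of functions, for all convex domains at once: apply the hypothesis on
  the part of the domain where the new function is negative, then separate the resulting
  combination from the new function.
\<close>

lemma convex_alternative:
  fixes F :: "'i \<Rightarrow> 'a::real_vector \<Rightarrow> real"
  assumes "finite I" "convex C" and "\<And>i. i \<in> I \<Longrightarrow> convex_on C (F i)"
    and "C \<noteq> {}" and "\<not> (\<exists>x\<in>C. \<forall>i\<in>I. F i x < 0)"
  shows "\<exists>w. (\<forall>i\<in>I. 0 \<le> w i) \<and> (\<exists>i\<in>I. w i \<noteq> (0::real)) \<and> (\<forall>x\<in>C. 0 \<le> (\<Sum>i\<in>I. w i * F i x))"
  using assms
proof (induction I arbitrary: C rule: finite_induct)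
  case empty
  then show ?case
    by auto
next
  case (insert m I)
  define C' where "C' = {x \<in> C. F m x < 0}"
  show ?case
  proof (cases "C' = {}")
    \<comment> \<open>Here \<open>F m\<close> is nonnegative on all of \<open>C\<close>, so unit
      weight on \<open>m\<close> alone suffices.\<close>
    case True
    have "(\<Sum>i\<in>insert m I. (if i = m then 1 else 0) * F i x) = F m x" for x
    proof -
      have "(\<Sum>i\<in>insert m I. (if i = m then 1 else 0) * F i x)
          = (\<Sum>i\<in>insert m I. if i = m then F i x else 0)"
        by (rule sum.cong) auto
      then show ?thesis
        using insert.hyps by simp
    qed
    with True show ?thesis
      by (intro exI[of _ "\<lambda>i. if i = m then 1 else 0"]) (auto simp: C'_def not_less)
  next
    case False
    then obtain x0 where x0: "x0 \<in> C" "F m x0 < 0"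
      by (auto simp: C'_def)
    have "convex C'"
      unfolding C'_def using insert.prems(2)[of m] by (intro convex_sublevel) simp
    moreover have "convex_on C' (F i)" if "i \<in> I" for i
      using insert.prems(2)[of i] that \<open>convex C'\<close>
      by (auto intro: convex_on_subset simp: C'_def)
    moreover have "\<not> (\<exists>x\<in>C'. \<forall>i\<in>I. F i x < 0)"
      using insert.prems(4) by (auto simp: C'_def)
    ultimately obtain w where w: "\<forall>i\<in>I. 0 \<le> w i" "\<exists>i\<in>I. w i \<noteq> 0"
      "\<forall>x\<in>C'. 0 \<le> (\<Sum>i\<in>I. w i * F i x)"
      using insert.IH[of C'] False by blast
    have "convex_on C (\<lambda>x. \<Sum>i\<in>I. w i * F i x)"
      using w(1) insert.prems(1,2) insert.hyps(1)
      by (intro convex_on_finite_sum convex_on_cmul) auto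
    then obtain \<kappa> where \<kappa>: "0 \<le> \<kappa>" "\<forall>x\<in>C. 0 \<le> \<kappa> * F m x + (\<Sum>i\<in>I. w i * F i x)"
      using convex_nonneg_multiplier[of C "F m" "\<lambda>x. \<Sum>i\<in>I. w i * F i x" x0] insert.prems(2) x0 w(3)
      by (auto simp: C'_def)
    \<comment> \<open>Since \<open>m\<close> is not in \<open>I\<close>, the update leaves the
      earlier weights intact. They are already nontrivial, so \<kappa> may be 0.\<close>
    have "(\<Sum>i\<in>insert m I. (w(m := \<kappa>)) i * F i x) = \<kappa> * F m x + (\<Sum>i\<in>I. w i * F i x)" for x
    proof -
      have "(\<Sum>i\<in>I. (w(m := \<kappa>)) i * F i x) = (\<Sum>i\<in>I. w i * F i x)"
        using insert.hyps(2) by (intro sum.cong) auto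
      then show ?thesis
        using insert.hyps by simp
    qed
    moreover have "\<exists>i\<in>insert m I. (w(m := \<kappa>)) i \<noteq> 0"
      using w(2) insert.hyps(2) by auto
    ultimately show ?thesis
      using \<kappa> w(1) by (intro exI[of _ "w(m := \<kappa>)"]) simp
  qed
qed

section \<open>Duality\<close>

lemma RD_degree_ge:
  assumes "\<And>i. i \<le> k \<Longrightarrow> 1 \<le> s i"
  shows "l \<in> {1..s 0} \<Longrightarrow> poly_degree (\<lambda>x. f 0 x (v 0 l)) \<le> RD_degree k s v f"
    and "i \<in> {1..k} \<Longrightarrow> j \<in> {1..s i} \<Longrightarrow> poly_degree (\<lambda>x. f i x (v i j)) \<le> RD_degree k s v f"
proof -
  let ?A = "MAX l\<in>{1..s 0}. poly_degree (\<lambda>x. f 0 x (v 0 l))"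
  let ?B = "\<lambda>i. MAX j\<in>{1..s i}. poly_degree (\<lambda>x. f i x (v i j))"
  let ?M = "max ?A (MAX i\<in>{1..k}. ?B i)"
  \<comment> \<open>Twice the maximal degree is an even upper bound, so the \<open>LEAST\<close> in
    \<open>RD_degree\<close> is attained.\<close>
  have "\<exists>t. even t \<and> ?M \<le> t"
    by (rule exI[of _ "2 * ?M"], rule conjI[OF dvd_triv_left]) (rule le_add1[of ?M ?M, folded mult_2])
  then have M: "?M \<le> RD_degree k s v f"
    unfolding RD_degree_def by (rule LeastI2_ex) blast
  {
    assume "l \<in> {1..s 0}"
    then have "poly_degree (\<lambda>x. f 0 x (v 0 l)) \<le> ?A"
      by (intro Max_ge) auto
    also note max.cobounded1
    also note M
    finally show "poly_degree (\<lambda>x. f 0 x (v 0 l)) \<le> RD_degree k s v f" .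
  }
  assume i: "i \<in> {1..k}" and "j \<in> {1..s i}"
  then have "poly_degree (\<lambda>x. f i x (v i j)) \<le> ?B i"
    by (intro Max_ge) auto
  also have "\<dots> \<le> (MAX i\<in>{1..k}. ?B i)"
    using i by (intro Max_ge) auto
  also note max.cobounded2
  also note M
  finally show "poly_degree (\<lambda>x. f i x (v i j)) \<le> RD_degree k s v f" .
qed

text \<open>At a primal feasible point the constraint terms are nonpositive, so \<mu> is at most a
  weighted average of the objectives and therefore at most one of them.\<close>

lemma weak_duality:
  assumes V: "\<And>i. i \<le> k \<Longrightarrow> V i = v i ` {1..s i}"
  shows "RD_value k s v f \<le> RP_value k V f"
  unfolding RD_value_def RP_value_def
proof (intro SUP_least INF_greatest, clarify)
  fix \<delta> \<Lambda> \<mu> x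
  assume D: "(\<delta>, \<Lambda>, \<mu>) \<in> RD_feasible k s v f" and x: "x \<in> RP_feasible k V f"
  have \<delta>: "\<forall>l\<in>{1..s 0}. 0 \<le> \<delta> l" "(\<Sum>l=1..s 0. \<delta> l) = 1"
    and \<Lambda>: "\<forall>i\<in>{1..k}. \<forall>j\<in>{1..s i}. 0 \<le> \<Lambda> i j"
    using D by (auto simp: RD_feasible_def simplex_weights_def)
  have "sum_of_squares (\<lambda>x. (\<Sum>l=1..s 0. \<delta> l * f 0 x (v 0 l))
      + (\<Sum>i=1..k. \<Sum>j=1..s i. \<Lambda> i j * f i x (v i j)) - \<mu>)"
    using D by (simp add: RD_feasible_def SOS_deg_def)
  from sum_of_squares_nonneg[OF this, of x]
  have "\<mu> \<le> (\<Sum>l=1..s 0. \<delta> l * f 0 x (v 0 l))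
      + (\<Sum>i=1..k. \<Sum>j=1..s i. \<Lambda> i j * f i x (v i j))"
    by simp
  also have "\<dots> \<le> (\<Sum>l=1..s 0. \<delta> l * f 0 x (v 0 l)) + 0"
    using x \<Lambda> V by (intro add_left_mono sum_nonpos mult_nonneg_nonpos) (auto simp: RP_feasible_def)
  finally have \<mu>: "\<mu> \<le> (\<Sum>l=1..s 0. \<delta> l * f 0 x (v 0 l))"
    by simp
  have "\<exists>l\<in>{1..s 0}. \<mu> \<le> f 0 x (v 0 l)"
  proof (rule ccontr)
    assume "\<not> ?thesis"
    then have less: "\<And>l. l \<in> {1..s 0} \<Longrightarrow> f 0 x (v 0 l) < \<mu>"
      by (auto simp: not_le)
    \<comment> \<open>An index of positive weight, which exists because the weights sum to 1, makes
      the averaged inequality strict.\<close>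
    obtain m where m: "m \<in> {1..s 0}" "0 < \<delta> m"
    proof (rule ccontr)
      assume "\<not> thesis"
      then have "(\<Sum>l=1..s 0. \<delta> l) \<le> 0"
        using that by (intro sum_nonpos) (meson not_le)
      then show False
        using \<delta>(2) by simp
    qed
    have "(\<Sum>l=1..s 0. \<delta> l * f 0 x (v 0 l)) < (\<Sum>l=1..s 0. \<delta> l * \<mu>)"
      using m less \<delta>(1)
      by (intro sum_strict_mono_ex1 ballI bexI[of _ m] mult_left_mono mult_strict_left_mono)
        (auto simp: less_imp_le)
    also have "\<dots> = \<mu>"
      using \<delta>(2) by (simp flip: sum_distrib_right)
    finally show False
      using \<mu> by simp
  qed
  then show "ereal \<mu> \<le> (SUP w\<in>V 0. ereal (f 0 x w))"
    using V[of 0] by (auto intro: SUP_upper2)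
qed

text \<open>Gives both the reverse inequality and dual attainment when the primal value is finite,
  since the dual point it produces has exactly that value.\<close>

lemma strong_duality:
  fixes f :: "nat \<Rightarrow> real^'n::finite \<Rightarrow> 'v \<Rightarrow> real"
  assumes s: "\<And>i. i \<le> k \<Longrightarrow> 1 \<le> s i"
    and V: "\<And>i. i \<le> k \<Longrightarrow> V i = v i ` {1..s i}"
    and sos: "\<And>i w. i \<le> k \<Longrightarrow> w \<in> V i \<Longrightarrow> SOS_convex (\<lambda>x. f i x w)"
    and slater: "\<forall>i\<in>{1..k}. \<forall>j\<in>{1..s i}. f i xbar (v i j) < 0"
    and \<mu>: "ereal \<mu> = RP_value k V f"
  shows "\<exists>\<delta> \<Lambda>. (\<delta>, \<Lambda>, \<mu>) \<in> RD_feasible k s v f"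
proof -
  define I where "I = (SIGMA i:{0..k}. {1..s i})"
  \<comment> \<open>Objectives and constraints form one family; only the objectives, with index
    \<open>i = 0\<close>, are shifted by the optimal value.\<close>
  define F where "F = (\<lambda>(i, j) x. f i x (v i j) - (if i = 0 then \<mu> else 0))"
  have taylor: "taylor_SOS (\<lambda>x. f i x (v i j))" if "i \<le> k" "j \<in> {1..s i}" for i j
    using sos V that by (intro SOS_convex_imp_taylor_SOS) blast
  have poly: "real_polynomial_function (\<lambda>x. f i x (v i j))" if "i \<le> k" "j \<in> {1..s i}" for i j
    using taylor[OF that] by (simp add: taylor_SOS_def)
  have taylorF: "taylor_SOS (F ij)" if "ij \<in> I" for ij
  proof -
    obtain i j where ij: "ij = (i, j)"
      by fastforce
    have "taylor_SOS (\<lambda>x. f i x (v i j) + - (if i = 0 then \<mu> else 0))"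
      using that by (intro taylor_SOS_add taylor taylor_SOS_const) (auto simp: I_def ij)
    then show ?thesis
      by (simp add: F_def ij)
  qed
  have "finite I"
    by (simp add: I_def)
  have sumI: "(\<Sum>ij\<in>I. g ij) = (\<Sum>l=1..s 0. g (0, l)) + (\<Sum>i=1..k. \<Sum>j=1..s i. g (i, j))"
    for g :: "nat \<times> nat \<Rightarrow> real"
  proof -
    have "(\<Sum>ij\<in>I. g ij) = (\<Sum>i=0..k. \<Sum>j=1..s i. g (i, j))"
      unfolding I_def by (simp add: sum.Sigma)
    then show ?thesis
      by (simp add: sum.atLeast_Suc_atMost)
  qed
  have "\<not> (\<exists>x\<in>UNIV. \<forall>ij\<in>I. F ij x < 0)"
  proof
    assume "\<exists>x\<in>UNIV. \<forall>ij\<in>I. F ij x < 0"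
    then obtain x where "\<forall>ij\<in>I. F ij x < 0"
      by blast
    then have x: "\<And>i j. i \<le> k \<Longrightarrow> j \<in> {1..s i} \<Longrightarrow> F (i, j) x < 0"
      by (auto simp: I_def)
    have "x \<in> RP_feasible k V f"
      unfolding RP_feasible_def
    proof (intro CollectI ballI)
      fix i w
      assume i: "i \<in> {1..k}" and "w \<in> V i"
      then obtain j where "j \<in> {1..s i}" "w = v i j"
        using V by auto
      then show "f i x w \<le> 0"
        using x[of i j] i by (simp add: F_def)
    qed
    then have "ereal \<mu> \<le> (SUP w\<in>V 0. ereal (f 0 x w))"
      unfolding \<mu> RP_value_def by (rule INF_lower)
    \<comment> \<open>A supremum over a finite nonempty set is a maximum, so the strict inequalities
      pass to it.\<close>
    also have "\<dots> = Max ((\<lambda>w. ereal (f 0 x w)) ` V 0)"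
      using V[of 0] s[of 0] by (intro Max_Sup[symmetric]) auto
    also have "\<dots> < ereal \<mu>"
      using V[of 0] s[of 0] x[of 0] by (subst Max_less_iff) (auto simp: F_def)
    finally show False
      by simp
  qed
  then have "\<exists>w. (\<forall>ij\<in>I. 0 \<le> w ij) \<and> (\<exists>ij\<in>I. w ij \<noteq> (0::real)) \<and>
      (\<forall>x\<in>UNIV. 0 \<le> (\<Sum>ij\<in>I. w ij * F ij x))"
    by (intro convex_alternative \<open>finite I\<close> convex_UNIV taylor_SOS_imp_convex_on taylorF UNIV_not_empty)
  then obtain w where w: "\<forall>ij\<in>I. 0 \<le> w ij" "\<exists>ij\<in>I. w ij \<noteq> 0"
    "\<forall>x\<in>UNIV. 0 \<le> (\<Sum>ij\<in>I. w ij * F ij x)"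
    by (elim exE conjE) (rule that)
  define \<sigma> where "\<sigma> = (\<Sum>l=1..s 0. w (0, l))"
  \<comment> \<open>If all objective weights vanished, some constraint would carry positive weight,
    and the combination would be negative at the Slater point.\<close>
  have \<sigma>: "0 < \<sigma>"
  proof (rule ccontr)
    assume "\<not> 0 < \<sigma>"
    moreover have w0: "0 \<le> w (0, l)" if "l \<in> {1..s 0}" for l
      using w(1) that by (auto simp: I_def)
    ultimately have "\<sigma> = 0"
      unfolding \<sigma>_def by (meson not_less order_antisym sum_nonneg)
    then have zero: "w (0, l) = 0" if "l \<in> {1..s 0}" for l
      using that w0 unfolding \<sigma>_def by (subst (asm) sum_nonneg_eq_0_iff) auto
    obtain i j where ij: "(i, j) \<in> I" "w (i, j) \<noteq> 0"
      using w(2) by fast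
    then have j: "i \<le> k" "j \<in> {1..s i}"
      by (auto simp: I_def)
    have "0 \<le> w (i, j)"
      using w(1) ij(1) by blast
    moreover have "i \<noteq> 0"
    proof
      assume "i = 0"
      then show False
        using zero[of j] j ij(2) by simp
    qed
    ultimately have pos: "0 < w (i, j)" "i \<in> {1..k}" "j \<in> {1..s i}"
      using ij(2) j by auto
    have nonpos: "w ij * F ij xbar \<le> 0" if "ij \<in> I" for ij
    proof (cases "fst ij = 0")
      case True
      then show ?thesis
        using that zero[of "snd ij"] by (auto simp: I_def)
    next
      case False
      then have "F ij xbar < 0"
        using slater that by (auto simp: I_def F_def)
      then show ?thesis
        using w(1) that by (simp add: mult_nonneg_nonpos)
    qed
    have "F (i, j) xbar < 0"
      using slater pos by (simp add: F_def)
    then have "w (i, j) * F (i, j) xbar < 0"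
      using pos by (simp add: mult_pos_neg)
    then have "(\<Sum>ij\<in>I. w ij * F ij xbar) < (\<Sum>ij\<in>I. 0)"
      using \<open>finite I\<close> nonpos ij by (intro sum_strict_mono_ex1) blast+
    then show False
      using w(3) by (simp add: not_less[symmetric])
  qed
  define \<delta> where "\<delta> = (\<lambda>l. w (0, l) / \<sigma>)"
  define \<Lambda> where "\<Lambda> = (\<lambda>i j. w (i, j) / \<sigma>)"
  let ?g = "\<lambda>x. (\<Sum>l=1..s 0. \<delta> l * f 0 x (v 0 l)) + (\<Sum>i=1..k. \<Sum>j=1..s i. \<Lambda> i j * f i x (v i j)) - \<mu>"
  have nonneg: "\<And>l. l \<in> {1..s 0} \<Longrightarrow> 0 \<le> \<delta> l" "\<And>i j. i \<in> {1..k} \<Longrightarrow> j \<in> {1..s i} \<Longrightarrow> 0 \<le> \<Lambda> i j"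
    using w(1) \<sigma> by (auto simp: \<delta>_def \<Lambda>_def I_def)
  have sum1: "(\<Sum>l=1..s 0. \<delta> l) = 1"
    using \<sigma> by (simp add: \<delta>_def \<sigma>_def flip: sum_divide_distrib)
  have g: "?g x = (\<Sum>ij\<in>I. w ij / \<sigma> * F ij x)" for x
  proof -
    \<comment> \<open>The normalised weights sum to 1, so shifting every objective by \<mu> shifts
      the average by exactly \<mu>.\<close>
    have "(\<Sum>l=1..s 0. \<delta> l * (f 0 x (v 0 l) - \<mu>)) = (\<Sum>l=1..s 0. \<delta> l * f 0 x (v 0 l)) - \<mu>"
      using sum1 by (simp add: right_diff_distrib sum_subtractf flip: sum_distrib_right)
    then show ?thesis
      unfolding sumI by (simp add: F_def \<delta>_def \<Lambda>_def)
  qed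
  have "taylor_SOS ?g"
    unfolding g using w(1) \<sigma> by (intro taylor_SOS_sum taylor_SOS_cmult taylorF) auto
  moreover have "0 \<le> ?g x" for x
  proof -
    have "?g x = (\<Sum>ij\<in>I. w ij * F ij x) / \<sigma>"
      unfolding g by (simp add: sum_divide_distrib)
    then show ?thesis
      using w(3) \<sigma> by simp
  qed
  ultimately have "sum_of_squares ?g"
    by (rule nonneg_taylor_SOS_imp_sum_of_squares)
  moreover have "real_polynomial_function ?g"
    using \<open>taylor_SOS ?g\<close> by (simp add: taylor_SOS_def)
  moreover have "degree_at_most (RD_degree k s v f)
      (\<lambda>x. (\<Sum>l=1..s 0. \<delta> l * f 0 x (v 0 l)) + (\<Sum>i=1..k. \<Sum>j=1..s i. \<Lambda> i j * f i x (v i j)) + - \<mu>)"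
    by (intro degree_at_most_add degree_at_most_sum degree_at_most_cmult degree_at_most_const
        degree_at_most_poly_degree poly RD_degree_ge s) auto
  then have "poly_degree ?g \<le> RD_degree k s v f"
    by (intro poly_degree_le) simp
  ultimately have "(\<delta>, \<Lambda>, \<mu>) \<in> RD_feasible k s v f"
    using nonneg sum1 by (simp add: RD_feasible_def SOS_deg_def simplex_weights_def)
  then show ?thesis
    by blast
qed

theorem theorem4p1:
  fixes k :: nat
    and d s :: "nat \<Rightarrow> nat"
    and V :: "nat \<Rightarrow> (nat \<Rightarrow> real) set"
    and v :: "nat \<Rightarrow> nat \<Rightarrow> (nat \<Rightarrow> real)"
    and f :: "nat \<Rightarrow> real^'n::finite \<Rightarrow> (nat \<Rightarrow> real) \<Rightarrow> real"
  assumes "1 \<le> k"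
    and "\<And>i. i \<le> k \<Longrightarrow> 1 \<le> s i"
    and "\<And>i. i \<le> k \<Longrightarrow> V i = v i ` {1..s i}"
    and "\<And>i. i \<le> k \<Longrightarrow> V i \<subseteq> topspace (Euclidean_space (d i))"
    and "\<And>i w. i \<le> k \<Longrightarrow> w \<in> V i \<Longrightarrow> SOS_convex (\<lambda>x. f i x w)"
    and "\<exists>x0. \<forall>i\<in>{1..k}. \<forall>j\<in>{1..s i}. f i x0 (v i j) < 0"
  shows "RP_value k V f = RD_value k s v f \<and>
    (RD_value k s v f \<noteq> -\<infinity> \<longrightarrow>
       (\<exists>(\<delta>, \<Lambda>, \<mu>)\<in>RD_feasible k s v f. ereal \<mu> = RD_value k s v f))"
proof -
  have weak: "RD_value k s v f \<le> RP_value k V f"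
    using assms(3) by (rule weak_duality)
  obtain x0 where x0: "\<forall>i\<in>{1..k}. \<forall>j\<in>{1..s i}. f i x0 (v i j) < 0"
    using assms(6) by blast
  \<comment> \<open>The Slater point is feasible and its objective is a maximum of finitely many
    reals, which excludes the value +\<infinity>.\<close>
  have "RP_value k V f \<le> (SUP w\<in>V 0. ereal (f 0 x0 w))"
    unfolding RP_value_def
    using x0 assms(3) by (intro INF_lower) (auto simp: RP_feasible_def intro: less_imp_le)
  also have "\<dots> = Max ((\<lambda>w. ereal (f 0 x0 w)) ` V 0)"
    using assms(2)[of 0] assms(3)[of 0] by (intro Max_Sup[symmetric]) auto
  also have "\<dots> < \<infinity>"
    using assms(2)[of 0] assms(3)[of 0] by (subst Max_less_iff) auto
  finally have "RP_value k V f \<noteq> \<infinity>"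
    by simp
  then consider "RP_value k V f = -\<infinity>" | \<mu> where "RP_value k V f = ereal \<mu>"
    by (cases "RP_value k V f") auto
  then show ?thesis
  proof cases
    \<comment> \<open>Weak duality forces the dual value to be -\<infinity> as well, so there is
      nothing to attain.\<close>
    case 1
    then show ?thesis
      using weak by simp
  next
    case 2
    then obtain \<delta> \<Lambda> where D: "(\<delta>, \<Lambda>, \<mu>) \<in> RD_feasible k s v f"
      using strong_duality[where k = k and s = s and V = V and v = v and f = f and xbar = x0
          and \<mu> = \<mu>, OF assms(2,3,5) x0] by auto
    then have "ereal \<mu> \<le> RD_value k s v f"
      unfolding RD_value_def by (force intro: SUP_upper2)
    then have "RD_value k s v f = ereal \<mu>"
      using weak 2 by simp
    then show ?thesis
      using 2 D by fastforce
  qed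
qed

end
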